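(* Let $N,n\ge1$ be integers and let $l^{(1)},\dots,l^{(N)}\in\mathbb Z^{N+n}$, $l^{(i)}=(l^{(i)}_0,\dots,l^{(i)}_{N+n-1})$, be charge vectors of a toric Calabi-Yau $n$-fold, so $\sum_{j} l^{(i)}_j=0$ for each $i$. Define vectors in $\mathbb Z^{N+n+2}$ by $$L^{(i)}=(l^{(i)}_0,\dots,l^{(i)}_{N+n-1},0,0)\ (1\le i\le N),\qquad L^{(0)}=(1,-1,0,\dots,0,-1,1)$$ (outer brane), and $$\tilde L^{(i)}=L^{(i)}\ (2\le i\le N),\qquad \tilde L^{(1)}=L^{(1)}+L^{(0)},\qquad \tilde L^{(0)}=-L^{(0)}$$ (inner brane). (1) If $\vec L=(L^{(0)},\dots,L^{(N)})$ satisfies Condition (A) and Condition (B), then the associated local open-closed mirror map is given by integral series: $$Q_i\in z_i\,\mathbb Z[[z_0,z_1,\dots,z_N]],\qquad i=0,1,\dots,N.$$ (2) If $\vec{\tilde L}=(\tilde L^{(0)},\dots,\tilde L^{(N)})$ satisfies Condition (A) and Condition (B), then the associated local open-closed mirror map is given by integral series: $$\tilde Q_i\in \tilde z_i\,\mathbb Z[[\tilde z_0,\tilde z_1,\dots,\tilde z_N]],\qquad i=0,1,\dots,N.$$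
   Context: Let $\mathbb Z_+$ be the set of nonnegative integers. The following is stated for $\vec L=(L^{(0)},\dots,L^{(N)})$, $L^{(i)}=(L^{(i)}_0,\dots,L^{(i)}_{N+n+1})$, with formal variables $z_0,\dots,z_N$; for $\vec{\tilde L}$ use the same definitions with $\tilde L^{(i)}$ in place of $L^{(i)}$ and formal variables $\tilde z_0,\dots,\tilde z_N$, obtaining $\tilde Q_i$. For $\vec M=(m_0,\dots,m_N)$ put $k_j(\vec L,\vec M)=\sum_{i=0}^N L^{(i)}_j m_i$ ($0\le j\le N+n+1$), and use the same formula $k_j(\vec L,\vec R)$ for formal parameters $\vec R=(r_0,\dots,r_N)$. For $\vec M\in\mathbb Z_+^{N+1}$ let $N(\vec L,\vec M)=|\{j: 0\le j\le N+n+1,\ k_j(\vec L,\vec M)<0\}|$. Condition (A): for $\vec M\in\mathbb Z_+^{N+1}$, $N(\vec L,\vec M)=0$ implies $\vec M=\vec 0$. Condition (B): for every $\vec M\in\mathbb Z_+^{N+1}$ with $N(\vec L,\vec M)=1$ and $\gcd(m_0,\dots,m_N)=1$, one has $\gcd\{k_j(\vec L,\vec M): 0\le j\le N+n+1\}=1$. Define $$\Omega=\sum_{\vec M\in\mathbb Z_+^{N+1}} C(\vec M,\vec R)\prod_{i=0}^N z_i^{r_i+m_i},\qquad C(\vec M,\vec R)=\frac{\prod_{j:\,k_j(\vec L,\vec M)<0}\ \prod_{b=0}^{-k_j(\vec L,\vec M)-1}(-b+k_j(\vec L,\vec R))}{\prod_{j:\,k_j(\vec L,\vec M)>0}\ \prod_{a=1}^{k_j(\vec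 L,\vec M)}(a+k_j(\vec L,\vec R))}.$$ Set $G_0=\Omega|_{\vec R=0}$ and $G_1^{(i)}=\partial_{r_i}\Omega|_{\vec R=0}$. Under Condition (A), $G_0=1$ and $$G_1^{(i)}=\log z_i+\sum_{\vec M\in\mathbb Z_+^{N+1},\ N(\vec L,\vec M)=1} L^{(i)}_{j_{\vec M}}\,\frac{(-1)^{k_{j_{\vec M}}(\vec L,\vec M)+1}\,(-k_{j_{\vec M}}(\vec L,\vec M)-1)!}{\prod_{j\ne j_{\vec M}}k_j(\vec L,\vec M)!}\ \prod_{s=0}^N z_s^{m_s},$$ where $j_{\vec M}$ is the unique index $j$ with $k_j(\vec L,\vec M)<0$. The local open-closed mirror map is $Q_i=\exp(G_1^{(i)}/G_0)$, i.e. $z_i$ times the exponential of the power series part of $G_1^{(i)}$. *)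

theory Defs
  imports "HOL-Analysis.Analysis" "HOL-Library.Poly_Mapping"
begin

section \<open>Formal power series in a family of variables\<close>

text \<open>A formal power series with variables in \<open>'v\<close> is an arbitrary function from the
  (finitely supported) exponents to the coefficients.\<close>

typedef ('v, 'a) mfps = "UNIV :: (('v \<Rightarrow>\<^sub>0 nat) \<Rightarrow> 'a) set"
  morphisms mfps_nth Abs_mfps
  by simp

lemma mfps_nth_Abs [simp]: "mfps_nth (Abs_mfps f) = f"
  by (simp add: Abs_mfps_inverse)

lemma mfps_eqI: "(\<And>e. mfps_nth f e = mfps_nth g e) \<Longrightarrow> f = g"
  by (metis mfps_nth_inject ext)

definition splits :: "('v \<Rightarrow>\<^sub>0 nat) \<Rightarrow> (('v \<Rightarrow>\<^sub>0 nat) \<times> ('v \<Rightarrow>\<^sub>0 nat)) set" where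
  "splits e = {(a, b). a + b = e}"

lemma finite_splits [simp]: "finite (splits e)"
proof -
  let ?F = "{f. \<forall>x. (x \<in> Poly_Mapping.keys e \<longrightarrow>
      f x \<in> {..Max (insert 0 (Poly_Mapping.lookup e ` Poly_Mapping.keys e))}) \<and>
      (x \<notin> Poly_Mapping.keys e \<longrightarrow> f x = (0::nat))}"
  have fin: "finite ?F"
    by (rule finite_set_of_finite_funs) auto
  have sub: "Poly_Mapping.lookup a \<in> ?F" if "a + b = e" for a b
  proof -
    have le: "Poly_Mapping.lookup a x \<le> Poly_Mapping.lookup e x" for x
      using that by (auto simp: lookup_add)
    have "Poly_Mapping.lookup a x \<le> Max (insert 0 (Poly_Mapping.lookup e ` Poly_Mapping.keys e))"
      if "x \<in> Poly_Mapping.keys e" for x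
    proof -
      have "Poly_Mapping.lookup e x \<le>
          Max (insert 0 (Poly_Mapping.lookup e ` Poly_Mapping.keys e))"
        using that by (intro Max_ge) auto
      with le[of x] show ?thesis by linarith
    qed
    moreover have "Poly_Mapping.lookup a x = 0" if "x \<notin> Poly_Mapping.keys e" for x
      using le[of x] that by (simp add: in_keys_iff)
    ultimately show ?thesis by auto
  qed
  have left: "finite {a. \<exists>b. a + b = e}"
  proof (rule finite_imageD)
    show "finite (Poly_Mapping.lookup ` {a. \<exists>b. a + b = e})"
    proof (rule finite_subset[OF image_subsetI fin])
      fix a assume "a \<in> {a. \<exists>b. a + b = e}"
      then obtain b where "a + b = e" by blast
      then show "Poly_Mapping.lookup a \<in> ?F" by (rule sub)
    qed
    show "inj_on Poly_Mapping.lookup {a. \<exists>b. a + b = e}"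
      by (rule inj_onI) (simp only: Poly_Mapping.lookup_inject)
  qed
  have "{b. \<exists>a. a + b = e} = {a. \<exists>b. a + b = e}"
    by (simp add: add.commute)
  with left have "finite ({a. \<exists>b. a + b = e} \<times> {b. \<exists>a. a + b = e})"
    by simp
  then show ?thesis
    by (rule finite_subset[rotated]) (auto simp: splits_def)
qed

instantiation mfps :: (type, comm_ring_1) comm_ring_1
begin

definition "0 = Abs_mfps (\<lambda>e. 0)"
definition "1 = Abs_mfps (\<lambda>e. if e = 0 then 1 else 0)"
definition "f + g = Abs_mfps (\<lambda>e. mfps_nth f e + mfps_nth g e)"
definition "f - g = Abs_mfps (\<lambda>e. mfps_nth f e - mfps_nth g e)"
definition "- f = Abs_mfps (\<lambda>e. - mfps_nth f e)"
definition "f * g = Abs_mfps (\<lambda>e. \<Sum>(a, b)\<in>splits e. mfps_nth f a * mfps_nth g b)"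

instance
proof
  fix f g h :: "('a, 'b) mfps"
  show "f * g * h = f * (g * h)"
  proof (rule mfps_eqI)
    fix e
    let ?t = "\<lambda>a b c. mfps_nth f a * mfps_nth g b * mfps_nth h c"
    have "mfps_nth (f * g * h) e =
        (\<Sum>x\<in>splits e. \<Sum>y\<in>splits (fst x). ?t (fst y) (snd y) (snd x))"
      by (simp add: times_mfps_def case_prod_unfold sum_distrib_right)
    also have "\<dots> = (\<Sum>(x, y)\<in>Sigma (splits e) (\<lambda>x. splits (fst x)). ?t (fst y) (snd y) (snd x))"
      by (rule sum.Sigma) auto
    also have "\<dots> = (\<Sum>(x, y)\<in>Sigma (splits e) (\<lambda>x. splits (snd x)). ?t (fst x) (fst y) (snd y))"
      by (rule sum.reindex_bij_witness[where
            i = "\<lambda>((a, _), (b, c)). ((a + b, c), (a, b))" and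
            j = "\<lambda>((_, c), (a, b)). ((a, b + c), (b, c))"])
         (clarsimp simp: splits_def add.assoc)+
    also have "\<dots> = (\<Sum>x\<in>splits e. \<Sum>y\<in>splits (snd x). ?t (fst x) (fst y) (snd y))"
      by (rule sum.Sigma[symmetric]) auto
    also have "\<dots> = mfps_nth (f * (g * h)) e"
      by (simp add: times_mfps_def case_prod_unfold sum_distrib_left mult.assoc)
    finally show "mfps_nth (f * g * h) e = mfps_nth (f * (g * h)) e" .
  qed
  show "f * g = g * f"
    unfolding times_mfps_def
    by (rule arg_cong[where f = Abs_mfps], rule ext,
        rule sum.reindex_bij_witness[where i = prod.swap and j = prod.swap])
       (auto simp: splits_def add.commute mult.commute)
  show "1 * f = f"
  proof (rule mfps_eqI)
    fix e
    have "mfps_nth (1 * f) e = (\<Sum>x\<in>splits e. if x = (0, e) then mfps_nth f e else 0)"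
      unfolding times_mfps_def one_mfps_def
      by (auto intro!: sum.cong simp: splits_def)
    also have "\<dots> = (if (0, e) \<in> splits e then mfps_nth f e else 0)"
      by (rule sum.delta) simp
    also have "\<dots> = mfps_nth f e"
      by (simp add: splits_def)
    finally show "mfps_nth (1 * f) e = mfps_nth f e" .
  qed
  show "(f + g) * h = f * h + g * h"
    by (simp add: times_mfps_def plus_mfps_def case_prod_unfold distrib_right sum.distrib)
  show "f + g + h = f + (g + h)"
    by (simp add: plus_mfps_def add.assoc)
  show "f + g = g + f"
    by (simp add: plus_mfps_def add.commute)
  show "0 + f = f" "- f + f = 0" "f - g = f + - g"
    by (simp_all add: plus_mfps_def zero_mfps_def uminus_mfps_def minus_mfps_def
        mfps_nth_inverse)
  show "(0 :: ('a, 'b) mfps) \<noteq> 1"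
  proof
    assume "(0 :: ('a, 'b) mfps) = 1"
    then have "mfps_nth (0 :: ('a, 'b) mfps) 0 = mfps_nth 1 0"
      by simp
    then show False
      by (simp add: zero_mfps_def one_mfps_def)
  qed
qed

end

definition mfps_const :: "'a::comm_ring_1 \<Rightarrow> ('v, 'a) mfps" where
  "mfps_const c = Abs_mfps (\<lambda>e. if e = 0 then c else 0)"

definition mfps_var :: "'v \<Rightarrow> ('v, 'a::comm_ring_1) mfps" where
  "mfps_var v = Abs_mfps (\<lambda>e. if e = Poly_Mapping.single v 1 then 1 else 0)"

text \<open>Sum of a formally summable family, i.e. one in which every monomial occurs with non-zero
  coefficient in only finitely many members.\<close>

definition formal_sum :: "('i \<Rightarrow> ('v, 'a) mfps) \<Rightarrow> 'i set \<Rightarrow> ('v, 'a::comm_ring_1) mfps" where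
  "formal_sum f A = Abs_mfps (\<lambda>e. \<Sum>x\<in>{x \<in> A. mfps_nth (f x) e \<noteq> 0}. mfps_nth (f x) e)"

text \<open>Only meaningful for series with zero constant coefficient (the powers are then a formally
  summable family).\<close>

definition mfps_exp :: "('v, 'a::field_char_0) mfps \<Rightarrow> ('v, 'a) mfps" where
  "mfps_exp f = formal_sum (\<lambda>k. mfps_const (1 / fact k) * f ^ k) (UNIV :: nat set)"

text \<open>Only meaningful when \<open>g\<close> is a unit, i.e. has non-zero constant coefficient.\<close>

definition mfps_quot :: "('v, 'a::field) mfps \<Rightarrow> ('v, 'a) mfps \<Rightarrow> ('v, 'a) mfps" where
  "mfps_quot f g = (THE h. h * g = f)"


section \<open>The hypergeometric series and the mirror map\<close>

text \<open>A family \<open>L\<^sup>(\<^sup>0\<^sup>), \<dots>, L\<^sup>(\<^sup>N\<^sup>)\<close> of vectors in \<open>\<int>\<^bsup>N+n+2\<^esup>\<close> is a function \<open>L\<close> of which only the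
  values \<open>L i j\<close> with \<open>i \<le> N\<close> and \<open>j \<le> N + n + 1\<close> are relevant.\<close>

definition kval :: "nat \<Rightarrow> (nat \<Rightarrow> nat \<Rightarrow> int) \<Rightarrow> nat \<Rightarrow> (nat \<Rightarrow> 'a::ring_1) \<Rightarrow> 'a" where
  "kval N L j x = (\<Sum>i\<le>N. of_int (L i j) * x i)"

abbreviation kvalM :: "nat \<Rightarrow> (nat \<Rightarrow> nat \<Rightarrow> int) \<Rightarrow> nat \<Rightarrow> (nat \<Rightarrow> nat) \<Rightarrow> int" where
  "kvalM N L j M \<equiv> kval N L j (\<lambda>i. int (M i))"

text \<open>\<open>\<int>\<^sub>+\<^bsup>N+1\<^esup>\<close>, normalised to vanish outside the index range.\<close>

definition nonneg_vecs :: "nat \<Rightarrow> (nat \<Rightarrow> nat) set" where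
  "nonneg_vecs N = {M. \<forall>i>N. M i = 0}"

definition num_neg :: "nat \<Rightarrow> nat \<Rightarrow> (nat \<Rightarrow> nat \<Rightarrow> int) \<Rightarrow> (nat \<Rightarrow> nat) \<Rightarrow> nat" where
  "num_neg N n L M = card {j. j \<le> N + n + 1 \<and> kvalM N L j M < 0}"

definition condition_A :: "nat \<Rightarrow> nat \<Rightarrow> (nat \<Rightarrow> nat \<Rightarrow> int) \<Rightarrow> bool" where
  "condition_A N n L \<longleftrightarrow>
    (\<forall>M\<in>nonneg_vecs N. num_neg N n L M = 0 \<longrightarrow> M = (\<lambda>_. 0))"

definition condition_B :: "nat \<Rightarrow> nat \<Rightarrow> (nat \<Rightarrow> nat \<Rightarrow> int) \<Rightarrow> bool" where
  "condition_B N n L \<longleftrightarrow>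
    (\<forall>M\<in>nonneg_vecs N. num_neg N n L M = 1 \<and> Gcd (M ` {..N}) = 1 \<longrightarrow>
       Gcd ((\<lambda>j. kvalM N L j M) ` {..N + n + 1}) = 1)"

definition hyp_coeff ::
    "nat \<Rightarrow> nat \<Rightarrow> (nat \<Rightarrow> nat \<Rightarrow> int) \<Rightarrow> (nat \<Rightarrow> nat) \<Rightarrow> (nat \<Rightarrow> real) \<Rightarrow> real" where
  "hyp_coeff N n L M R =
     (\<Prod>j\<in>{j. j \<le> N + n + 1 \<and> kvalM N L j M < 0}.
        \<Prod>b<nat (- kvalM N L j M). - of_nat b + kval N L j R) /
     (\<Prod>j\<in>{j. j \<le> N + n + 1 \<and> kvalM N L j M > 0}.
        \<Prod>a=1..nat (kvalM N L j M). of_nat a + kval N L j R)"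

text \<open>The formal variables are the \<open>z\<^sub>i\<close> together with their logarithms, as independent symbols;
  \<open>z\<^sub>i\<^bsup>r+m\<^esup>\<close> stands for \<open>exp (r log z\<^sub>i) z\<^sub>i\<^bsup>m\<^esup>\<close>.\<close>

datatype var = Z nat | LogZ nat

definition zpow :: "nat \<Rightarrow> real \<Rightarrow> nat \<Rightarrow> (var, real) mfps" where
  "zpow i r m = mfps_exp (mfps_const r * mfps_var (LogZ i)) * mfps_var (Z i) ^ m"

definition Omega ::
    "nat \<Rightarrow> nat \<Rightarrow> (nat \<Rightarrow> nat \<Rightarrow> int) \<Rightarrow> (nat \<Rightarrow> real) \<Rightarrow> (var, real) mfps" where
  "Omega N n L R =
     formal_sum (\<lambda>M. mfps_const (hyp_coeff N n L M R) * (\<Prod>i\<le>N. zpow i (R i) (M i)))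
       (nonneg_vecs N)"

definition G0 :: "nat \<Rightarrow> nat \<Rightarrow> (nat \<Rightarrow> nat \<Rightarrow> int) \<Rightarrow> (var, real) mfps" where
  "G0 N n L = Omega N n L (\<lambda>_. 0)"

text \<open>Each coefficient of \<open>\<Omega>\<close> is a rational function of \<open>R\<close>, regular at \<open>R = 0\<close>, so the formal
  derivative in \<open>r\<^sub>i\<close> is the analytic one, taken coefficientwise.\<close>

definition G1 :: "nat \<Rightarrow> nat \<Rightarrow> (nat \<Rightarrow> nat \<Rightarrow> int) \<Rightarrow> nat \<Rightarrow> (var, real) mfps" where
  "G1 N n L i = Abs_mfps (\<lambda>e. deriv (\<lambda>r. mfps_nth (Omega N n L ((\<lambda>_. 0)(i := r))) e) 0)"

text \<open>The part of a series that does not involve any logarithm.\<close>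

definition power_series_part :: "(var, 'a::comm_ring_1) mfps \<Rightarrow> (var, 'a) mfps" where
  "power_series_part f =
     Abs_mfps (\<lambda>e. if Poly_Mapping.keys e \<subseteq> range Z then mfps_nth f e else 0)"

text \<open>\<open>exp (G\<^sub>1/G\<^sub>0)\<close>: the logarithmic part of \<open>G\<^sub>1/G\<^sub>0\<close> is \<open>log z\<^sub>i\<close>, whose exponential is \<open>z\<^sub>i\<close>.\<close>

definition mirror_map :: "nat \<Rightarrow> nat \<Rightarrow> (nat \<Rightarrow> nat \<Rightarrow> int) \<Rightarrow> nat \<Rightarrow> (var, real) mfps" where
  "mirror_map N n L i =
     mfps_var (Z i) * mfps_exp (power_series_part (mfps_quot (G1 N n L i) (G0 N n L)))"

text \<open>\<open>\<int>[[z\<^sub>0, \<dots>, z\<^sub>N]]\<close>\<close>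

definition integral_series :: "nat \<Rightarrow> (var, real) mfps set" where
  "integral_series N = {F. \<forall>e. mfps_nth F e \<in> \<int> \<and>
     (mfps_nth F e \<noteq> 0 \<longrightarrow> Poly_Mapping.keys e \<subseteq> Z ` {..N})}"


section \<open>The two brane configurations\<close>

text \<open>Row \<open>0\<close> is \<open>(1, -1, 0, \<dots>, 0, -1, 1)\<close>; the rows of \<open>l\<close> are indexed from \<open>1\<close>.\<close>

definition outer_brane :: "nat \<Rightarrow> nat \<Rightarrow> (nat \<Rightarrow> nat \<Rightarrow> int) \<Rightarrow> nat \<Rightarrow> nat \<Rightarrow> int" where
  "outer_brane N n l i j =
     (if i = 0 then
        (if j = 0 \<or> j = N + n + 1 then 1 else if j = 1 \<or> j = N + n then - 1 else 0)
      else if j < N + n then l i j else 0)"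

definition inner_brane :: "nat \<Rightarrow> nat \<Rightarrow> (nat \<Rightarrow> nat \<Rightarrow> int) \<Rightarrow> nat \<Rightarrow> nat \<Rightarrow> int" where
  "inner_brane N n l i j =
     (if i = 0 then - outer_brane N n l 0 j
      else if i = 1 then outer_brane N n l 1 j + outer_brane N n l 0 j
      else outer_brane N n l i j)"

end

theory Submission
  imports Defs "HOL-Number_Theory.Cong"
begin

text \<open>
  Up to the variable \<open>z\<^sub>i\<close>, the mirror map is the exponential of the series
  \<open>g = \<Sum>\<^sub>M a\<^sub>M z\<^sup>M\<close> that is left of \<open>G\<^sub>1/G\<^sub>0\<close> when the logarithms are dropped. Condition (A) forces
  \<open>G\<^sub>0 = 1\<close>, and \<open>a\<^sub>M\<close> is non-zero only if exactly one of the numbers \<open>k\<^sub>j(M)\<close> is negative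
  (\<open>deriv_hyp_coeff\<close>). The rows of \<open>L\<close> sum to zero, so if the negative one is \<open>- K\<close> then the
  others sum to \<open>K\<close>, and \<open>a\<^sub>M\<close> is an integer times \<open>\<plusminus> 1/K\<close> times the multinomial coefficient
  \<open>K! / \<Prod>\<^sub>j k\<^sub>j!\<close>.

  To see that \<open>exp g\<close> is integral, it is written as a product \<open>\<Prod>\<^sub>M (1 - s\<^sub>M z\<^sup>M)\<^bsup>-b\<^sub>M\<^esup>\<close> with integers \<open>b\<^sub>M\<close>
  and signs \<open>s\<^sub>M\<close> (\<open>int_series_exp\<close>). Taking logarithms and looking at the multiples \<open>m M\<close> of one
  primitive \<open>M\<close>, this requires that \<open>c\<^sub>m = m |a\<^bsub>m M\<^esub>|\<close>, freed of its constant integer factor, be of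
  the form \<open>\<Sum>\<^bsub>d | m\<^esub> d b\<^sub>d\<close> (\<open>int_series_exp_rays\<close>). Here \<open>c\<^sub>m\<close> is \<open>1/K\<close> times the multinomial
  coefficient of the \<open>m k\<^sub>j\<close>, and Condition (B) says that the \<open>k\<^sub>j\<close> have no common divisor. Therefore \<open>c\<^sub>m\<close> is an
  integer (\<open>prod_fact_dvd_Gcd_mult_fact\<close>), and such \<open>b\<^sub>d\<close> exist as soon as \<open>c\<^sub>m\<close> and \<open>c\<^bsub>m/p\<^esub>\<close> are
  congruent modulo every prime power \<open>p\<^sup>r\<close> dividing \<open>m\<close> (\<open>sum_divisors_necklace\<close>). That congruence
  compares factorials modulo \<open>p\<^sup>r\<close> (\<open>cyclic_multinomial_cong\<close>).

  This applies to any charge vectors that sum to zero (\<open>mirror_map_integral\<close>). Those of both branes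
  do: \<open>L\<^sup>0\<close> has two entries \<open>1\<close> and two entries \<open>-1\<close>, the others come from the Calabi-Yau
  condition, and the inner brane is obtained from the outer one by adding and negating rows.
\<close>

section \<open>The exponential of a power series in several variables\<close>

lemma mfps_nth_arith [simp]:
  "mfps_nth 0 e = 0"
  "mfps_nth 1 e = (if e = 0 then 1 else 0)"
  "mfps_nth (f + g) e = mfps_nth f e + mfps_nth g e"
  "mfps_nth (f - g) e = mfps_nth f e - mfps_nth g e"
  "mfps_nth (- f) e = - mfps_nth f e"
  by (simp_all add: zero_mfps_def one_mfps_def plus_mfps_def minus_mfps_def uminus_mfps_def)

lemma mfps_nth_mult: "mfps_nth (f * g) e = (\<Sum>(a, b)\<in>splits e. mfps_nth f a * mfps_nth g b)"
  by (simp add: times_mfps_def)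

lemma mfps_nth_sum [simp]: "mfps_nth (sum f A) e = (\<Sum>x\<in>A. mfps_nth (f x) e)"
  by (induction A rule: infinite_finite_induct) simp_all

lemma splits_0: "splits 0 = {(0, 0)}"
  by (auto simp: splits_def poly_mapping_eq_iff lookup_add fun_eq_iff)

lemma mfps_nth_mult_0 [simp]: "mfps_nth (f * g) 0 = mfps_nth f 0 * mfps_nth g 0"
  by (simp add: mfps_nth_mult splits_0)

definition mfps_monom :: "('v \<Rightarrow>\<^sub>0 nat) \<Rightarrow> ('v, 'a::comm_ring_1) mfps" where
  "mfps_monom f = Abs_mfps (\<lambda>e. if e = f then 1 else 0)"

lemma mfps_nth_monom [simp]: "mfps_nth (mfps_monom f) e = (if e = f then 1 else 0)"
  by (simp add: mfps_monom_def)

lemma mfps_nth_monom_mult: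
  "mfps_nth (mfps_monom f * g) (f + e) = mfps_nth g e"
proof -
  have "mfps_nth (mfps_monom f * g) (f + e) =
      (\<Sum>x\<in>splits (f + e). if x = (f, e) then mfps_nth g e else 0)"
    unfolding mfps_nth_mult by (rule sum.cong) (auto simp: splits_def split: if_splits)
  also have "\<dots> = mfps_nth g e"
    by (subst sum.delta[OF finite_splits]) (simp add: splits_def)
  finally show ?thesis .
qed

lemma mfps_nth_monom_mult_eq_0:
  "(\<And>b. e \<noteq> f + b) \<Longrightarrow> mfps_nth (mfps_monom f * g) e = 0"
  unfolding mfps_nth_mult by (rule sum.neutral) (auto simp: splits_def)

lemma mfps_monom_mult: "mfps_monom a * mfps_monom b = mfps_monom (a + b)"
proof (rule mfps_eqI)
  fix e
  show "mfps_nth (mfps_monom a * mfps_monom b) e = mfps_nth (mfps_monom (a + b)) e"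
  proof (cases "\<exists>c. e = a + c")
    case True
    then show ?thesis by (auto simp: mfps_nth_monom_mult)
  next
    case False
    then show ?thesis by (auto simp: mfps_nth_monom_mult_eq_0)
  qed
qed

lemma mfps_monom_0: "mfps_monom 0 = 1"
  by (rule mfps_eqI) simp

lemma mfps_nth_const_mult [simp]: "mfps_nth (mfps_const c * f) e = c * mfps_nth f e"
proof -
  have "mfps_nth (mfps_const c * f) e =
      (\<Sum>x\<in>splits e. if x = (0, e) then c * mfps_nth f e else 0)"
    unfolding mfps_nth_mult mfps_const_def
    by (rule sum.cong) (auto simp: splits_def split: if_splits)
  also have "\<dots> = c * mfps_nth f e"
    by (subst sum.delta[OF finite_splits]) (simp add: splits_def)
  finally show ?thesis .
qed

lemma mfps_const_arith:
  "mfps_const 1 = 1" "mfps_const 0 = 0"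
  "mfps_const a + mfps_const b = mfps_const (a + b)"
  "mfps_const a * mfps_const b = mfps_const (a * b)"
  by (rule mfps_eqI; simp; simp add: mfps_const_def)+


definition tdeg :: "('v \<Rightarrow>\<^sub>0 nat) \<Rightarrow> nat" where
  "tdeg e = (\<Sum>x\<in>Poly_Mapping.keys e. Poly_Mapping.lookup e x)"

lemma tdeg_eq_sum:
  "finite A \<Longrightarrow> Poly_Mapping.keys e \<subseteq> A \<Longrightarrow> tdeg e = (\<Sum>x\<in>A. Poly_Mapping.lookup e x)"
  unfolding tdeg_def by (rule sum.mono_neutral_left) (auto simp: in_keys_iff)

lemma tdeg_add [simp]: "tdeg (a + b) = tdeg a + tdeg b"
proof -
  let ?A = "Poly_Mapping.keys a \<union> Poly_Mapping.keys b"
  have "tdeg (a + b) = (\<Sum>x\<in>?A. Poly_Mapping.lookup (a + b) x)"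
    by (rule tdeg_eq_sum) (use Poly_Mapping.keys_add[of a b] in auto)
  moreover have "tdeg a = (\<Sum>x\<in>?A. Poly_Mapping.lookup a x)"
    "tdeg b = (\<Sum>x\<in>?A. Poly_Mapping.lookup b x)"
    by (rule tdeg_eq_sum; auto)+
  ultimately show ?thesis
    by (simp add: lookup_add sum.distrib)
qed

lemma tdeg_eq_0_iff [simp]: "tdeg e = 0 \<longleftrightarrow> e = 0"
  by (auto simp: tdeg_def in_keys_iff poly_mapping_eq_iff fun_eq_iff)

lemma tdeg_0 [simp]: "tdeg 0 = 0"
  by simp


text \<open>The Euler operator \<open>\<Sum>\<^sub>v x\<^sub>v \<partial>/\<partial>x\<^sub>v\<close>. In characteristic zero only constants are in its
  kernel, so this one derivation does the work of all the partial derivatives.\<close>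

definition mfps_euler :: "('v, 'a::comm_ring_1) mfps \<Rightarrow> ('v, 'a) mfps" where
  "mfps_euler f = Abs_mfps (\<lambda>e. of_nat (tdeg e) * mfps_nth f e)"

lemma mfps_nth_euler [simp]: "mfps_nth (mfps_euler f) e = of_nat (tdeg e) * mfps_nth f e"
  by (simp add: mfps_euler_def)

lemma mfps_euler_linear [simp]:
  "mfps_euler 1 = 0" "mfps_euler 0 = 0"
  "mfps_euler (f + g) = mfps_euler f + mfps_euler g"
  "mfps_euler (f - g) = mfps_euler f - mfps_euler g"
  "mfps_euler (mfps_const c * f) = mfps_const c * mfps_euler f"
  by (rule mfps_eqI; simp add: distrib_left right_diff_distrib mult.left_commute)+

lemma mfps_euler_mult: "mfps_euler (f * g) = mfps_euler f * g + f * mfps_euler g"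
proof (rule mfps_eqI)
  fix e
  have "mfps_nth (mfps_euler (f * g)) e =
      (\<Sum>(a, b)\<in>splits e. of_nat (tdeg a + tdeg b) * (mfps_nth f a * mfps_nth g b))"
    by (auto simp: mfps_nth_mult sum_distrib_left splits_def intro!: sum.cong)
  also have "\<dots> = mfps_nth (mfps_euler f * g + f * mfps_euler g) e"
    unfolding mfps_nth_arith mfps_nth_mult
    by (simp add: case_prod_unfold distrib_left distrib_right sum.distrib mult_ac)
  finally show "mfps_nth (mfps_euler (f * g)) e = mfps_nth (mfps_euler f * g + f * mfps_euler g) e" .
qed

lemma mfps_euler_power:
  "mfps_euler (f ^ Suc k) = mfps_const (of_nat (Suc k)) * (f ^ k * mfps_euler f)"
proof (induction k)
  case (Suc k)
  have "mfps_euler (f ^ Suc (Suc k)) =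
      mfps_euler f * f ^ Suc k + f * mfps_euler (f ^ Suc k)"
    by (subst power_Suc) (rule mfps_euler_mult)
  also have "\<dots> = mfps_const 1 * (f ^ Suc k * mfps_euler f) +
      mfps_const (of_nat (Suc k)) * (f ^ Suc k * mfps_euler f)"
    by (simp only: Suc.IH mfps_const_arith) (simp add: algebra_simps)
  also have "\<dots> = mfps_const (1 + of_nat (Suc k)) * (f ^ Suc k * mfps_euler f)"
    by (simp only: mfps_const_arith(3)[symmetric] distrib_right)
  finally show ?case by simp
qed (simp add: mfps_const_arith)


text \<open>The equation \<open>D h = h \<cdot> D f\<close> determines a coefficient of \<open>h\<close> of positive degree from those of lower degree,
  because \<open>D f\<close> has no constant term. Only the coefficients of \<open>f\<close> at exponents below \<open>e\<close>
  enter, and this locality is what later allows an infinite product to be replaced by a finite one.\<close>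

lemma mfps_ode_unique:
  fixes h h' f f' :: "('v, 'a::field_char_0) mfps"
  assumes ode: "mfps_euler h = h * mfps_euler f" "mfps_euler h' = h' * mfps_euler f'"
    and init: "mfps_nth h 0 = mfps_nth h' 0"
    and agree: "\<And>a b. a + b = e \<Longrightarrow> mfps_nth f a = mfps_nth f' a"
  shows "mfps_nth h e = mfps_nth h' e"
  using agree
proof (induction "tdeg e" arbitrary: e rule: less_induct)
  case (less e)
  show ?case
  proof (cases "e = 0")
    case False
    have "mfps_nth h a * mfps_nth (mfps_euler f) b = mfps_nth h' a * mfps_nth (mfps_euler f') b"
      if "a + b = e" for a b
    proof (cases "b = 0")
      case False
      have "mfps_nth h a = mfps_nth h' a"
      proof (rule less.hyps)
        show "tdeg a < tdeg e"
          using that False by (auto simp del: tdeg_eq_0_iff simp flip: tdeg_eq_0_iff)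
        show "mfps_nth f c = mfps_nth f' c" if "c + d = a" for c d
          by (rule less.prems[of c "d + b"]) (use that \<open>a + b = e\<close> in \<open>simp flip: add.assoc\<close>)
      qed
      moreover have "mfps_nth f b = mfps_nth f' b"
        using less.prems[of b a] that by (simp add: add.commute)
      ultimately show ?thesis by simp
    qed simp
    then have "mfps_nth (h * mfps_euler f) e = mfps_nth (h' * mfps_euler f') e"
      unfolding mfps_nth_mult by (intro sum.cong) (auto simp: splits_def)
    then have "of_nat (tdeg e) * mfps_nth h e = of_nat (tdeg e) * mfps_nth h' e"
      by (simp flip: ode)
    with False show ?thesis by simp
  qed (use init in simp)
qed

lemma mfps_nth_power_eq_0:
  "mfps_nth f 0 = 0 \<Longrightarrow> tdeg e < k \<Longrightarrow> mfps_nth (f ^ k) e = 0"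
proof (induction k arbitrary: e)
  case (Suc k)
  have "mfps_nth f a * mfps_nth (f ^ k) b = 0" if "a + b = e" for a b
  proof (cases "a = 0")
    case False
    then have "tdeg b < tdeg e"
      using that by (auto simp del: tdeg_eq_0_iff simp flip: tdeg_eq_0_iff)
    with Suc.prems have "tdeg b < k" by simp
    with Suc show ?thesis by simp
  qed (use Suc.prems in simp)
  then show ?case
    by (auto simp: mfps_nth_mult splits_def intro!: sum.neutral)
qed simp

lemma mfps_nth_exp:
  fixes f :: "('v, 'a::field_char_0) mfps"
  assumes "mfps_nth f 0 = 0" "tdeg e < n"
  shows "mfps_nth (mfps_exp f) e = mfps_nth (\<Sum>k<n. mfps_const (1 / fact k) * f ^ k) e"
proof -
  have "{k. mfps_nth (mfps_const (1 / fact k) * f ^ k) e \<noteq> 0} \<subseteq> {..<n}"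
    using assms mfps_nth_power_eq_0[of f e] by (auto simp: not_less intro: ccontr)
  then show ?thesis
    by (auto simp: mfps_exp_def formal_sum_def intro!: sum.mono_neutral_left)
qed

lemma mfps_nth_exp_0: "mfps_nth f 0 = 0 \<Longrightarrow> mfps_nth (mfps_exp f) 0 = 1"
  using mfps_nth_exp[of f 0 1] by (simp add: mfps_const_arith)

text \<open>The derivative of a partial sum of the exponential series is the preceding partial sum times \<open>D f\<close>,
  and a coefficient of the exponential is a coefficient of any sufficiently long partial sum.\<close>

lemma mfps_euler_exp:
  fixes f :: "('v, 'a::field_char_0) mfps"
  assumes f0: "mfps_nth f 0 = 0"
  shows "mfps_euler (mfps_exp f) = mfps_exp f * mfps_euler f"
proof (rule mfps_eqI)
  fix e
  define P where "P n = (\<Sum>k<n. mfps_const (1 / fact k) * f ^ k)" for n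
  have P: "mfps_euler (P (Suc n)) = P n * mfps_euler f" for n
  proof (induction n)
    case (Suc n)
    have "mfps_const (1 / fact (Suc n)) * mfps_const (of_nat (Suc n)) = (mfps_const (1 / fact n) :: ('v, 'a) mfps)"
      by (simp add: mfps_const_arith field_simps del: of_nat_Suc)
    then have "mfps_const (1 / fact (Suc n)) * mfps_euler (f ^ Suc n) =
        mfps_const (1 / fact n) * (f ^ n * mfps_euler f)"
      unfolding mfps_euler_power by (metis mult.assoc)
    then show ?case
      using Suc unfolding P_def by (simp add: distrib_right mult.assoc del: fact_Suc power_Suc)
  qed (simp add: P_def mfps_const_arith)
  have "mfps_nth (mfps_euler (mfps_exp f)) e = mfps_nth (mfps_euler (P (Suc (Suc (tdeg e))))) e"
    unfolding mfps_nth_euler P_def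
    by (subst mfps_nth_exp[OF f0, where n = "Suc (Suc (tdeg e))"]) simp_all
  also have "\<dots> = mfps_nth (P (Suc (tdeg e)) * mfps_euler f) e"
    by (simp only: P)
  also have "\<dots> = mfps_nth (mfps_exp f * mfps_euler f) e"
    unfolding mfps_nth_mult
  proof (intro sum.cong refl, clarify)
    fix a b assume "(a, b) \<in> splits e"
    then have "tdeg a < Suc (tdeg e)" by (auto simp: splits_def)
    then show "mfps_nth (P (Suc (tdeg e))) a * mfps_nth (mfps_euler f) b =
        mfps_nth (mfps_exp f) a * mfps_nth (mfps_euler f) b"
      unfolding P_def by (subst mfps_nth_exp[OF f0, where n = "Suc (tdeg e)"]) simp_all
  qed
  finally show "mfps_nth (mfps_euler (mfps_exp f)) e = mfps_nth (mfps_exp f * mfps_euler f) e" .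
qed

lemma mfps_exp_eqI:
  fixes f :: "('v, 'a::field_char_0) mfps"
  assumes "mfps_nth f 0 = 0" "mfps_nth h 0 = 1" "mfps_euler h = h * mfps_euler f"
  shows "mfps_exp f = h"
  by (rule mfps_eqI, rule mfps_ode_unique[of _ f _ f])
    (use assms in \<open>simp_all add: mfps_euler_exp mfps_nth_exp_0\<close>)

lemma mfps_exp_cong:
  fixes f :: "('v, 'a::field_char_0) mfps"
  assumes "mfps_nth f 0 = 0" "\<And>a b. a + b = e \<Longrightarrow> mfps_nth f a = mfps_nth g a"
  shows "mfps_nth (mfps_exp f) e = mfps_nth (mfps_exp g) e"
proof -
  have "mfps_nth g 0 = 0" using assms(1) assms(2)[of 0 e] by simp
  show ?thesis
  proof (rule mfps_ode_unique[of _ f _ g])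
    show "mfps_nth f a = mfps_nth g a" if "a + b = e" for a b
      using that by (rule assms(2))
  qed (use assms(1) \<open>mfps_nth g 0 = 0\<close> in \<open>simp_all add: mfps_euler_exp mfps_nth_exp_0\<close>)
qed

lemma mfps_exp_0: "mfps_exp (0 :: ('v, 'a::field_char_0) mfps) = 1"
  by (rule mfps_exp_eqI) simp_all

lemma mfps_exp_add:
  fixes f :: "('v, 'a::field_char_0) mfps"
  assumes "mfps_nth f 0 = 0" "mfps_nth g 0 = 0"
  shows "mfps_exp (f + g) = mfps_exp f * mfps_exp g"
  by (rule mfps_exp_eqI)
    (use assms in \<open>simp_all add: mfps_nth_exp_0 mfps_euler_mult mfps_euler_exp algebra_simps\<close>)

section \<open>Integrality of exponentials\<close>

definition exp_scale :: "nat \<Rightarrow> ('v \<Rightarrow>\<^sub>0 nat) \<Rightarrow> ('v \<Rightarrow>\<^sub>0 nat)" where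
  "exp_scale d f = Poly_Mapping.map ((*) d) f"

lemma lookup_exp_scale [simp]: "Poly_Mapping.lookup (exp_scale d f) x = d * Poly_Mapping.lookup f x"
  by (simp add: exp_scale_def map.rep_eq when_def)

lemma exp_scale_eqI:
  "(\<And>x. Poly_Mapping.lookup e x = d * Poly_Mapping.lookup f x) \<Longrightarrow> exp_scale d f = e"
  by (rule poly_mapping_eqI) simp

lemma exp_scale_simps [simp]: "exp_scale 0 f = 0" "exp_scale (Suc d) f = f + exp_scale d f"
  by (rule poly_mapping_eqI; simp add: lookup_add)+

lemma keys_exp_scale: "Poly_Mapping.keys (exp_scale d f) \<subseteq> Poly_Mapping.keys f"
  by (auto simp: in_keys_iff)

lemma tdeg_exp_scale [simp]: "tdeg (exp_scale d f) = d * tdeg f"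
  by (induction d) auto

lemma exp_scale_inj:
  assumes "f \<noteq> 0"
  shows "exp_scale d f = exp_scale d' f \<longleftrightarrow> d = d'"
proof
  assume "exp_scale d f = exp_scale d' f"
  then have "tdeg (exp_scale d f) = tdeg (exp_scale d' f)"
    by (rule arg_cong)
  with assms show "d = d'" by simp
qed simp

lemma finite_exp_scale_eq: "f \<noteq> 0 \<Longrightarrow> finite {d. d > 0 \<and> exp_scale d f = e}"
  by (rule finite_subset[of _ "{..tdeg e}"]) (auto simp flip: tdeg_eq_0_iff)


text \<open>The expansions of \<open>1 / (1 - s x\<^sup>f)\<close> and of \<open>- log (1 - s x\<^sup>f)\<close>. For \<open>f \<noteq> 0\<close> the sums have
  at most one term.\<close>

definition mfps_geom :: "'a \<Rightarrow> ('v \<Rightarrow>\<^sub>0 nat) \<Rightarrow> ('v, 'a::comm_ring_1) mfps" where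
  "mfps_geom s f = Abs_mfps (\<lambda>e. \<Sum>d\<in>{d. exp_scale d f = e}. s ^ d)"

definition mfps_log :: "'a \<Rightarrow> ('v \<Rightarrow>\<^sub>0 nat) \<Rightarrow> ('v, 'a::field_char_0) mfps" where
  "mfps_log s f = Abs_mfps (\<lambda>e. \<Sum>d\<in>{d. d > 0 \<and> exp_scale d f = e}. s ^ d / of_nat d)"

lemma mfps_nth_geom_scale:
  assumes "f \<noteq> 0"
  shows "mfps_nth (mfps_geom s f) (exp_scale d f) = s ^ d"
proof -
  have "{d'. exp_scale d' f = exp_scale d f} = {d}"
    using assms by (auto simp: exp_scale_inj)
  then show ?thesis by (simp add: mfps_geom_def)
qed

lemma mfps_nth_geom_eq_0:
  "(\<And>d. e \<noteq> exp_scale d f) \<Longrightarrow> mfps_nth (mfps_geom s f) e = 0"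
  unfolding mfps_geom_def mfps_nth_Abs by (rule sum.neutral) auto

lemma mfps_nth_log_scale:
  assumes "f \<noteq> 0" "d > 0"
  shows "mfps_nth (mfps_log s f) (exp_scale d f) = s ^ d / of_nat d"
proof -
  have "{d'. d' > 0 \<and> exp_scale d' f = exp_scale d f} = {d}"
    using assms by (auto simp: exp_scale_inj)
  then show ?thesis by (simp add: mfps_log_def)
qed

lemma mfps_nth_log_eq_0:
  "(\<And>d. d > 0 \<Longrightarrow> e \<noteq> exp_scale d f) \<Longrightarrow> mfps_nth (mfps_log s f) e = 0"
  unfolding mfps_log_def mfps_nth_Abs by (rule sum.neutral) auto

lemma mfps_nth_log_0: "f \<noteq> 0 \<Longrightarrow> mfps_nth (mfps_log s f) 0 = 0"
  by (rule mfps_nth_log_eq_0) (metis exp_scale_inj exp_scale_simps(1) less_irrefl)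

lemma mfps_geom_unfold:
  assumes "f \<noteq> 0"
  shows "mfps_geom s f = 1 + mfps_const s * (mfps_monom f * mfps_geom s f)"
proof (rule mfps_eqI)
  fix e
  consider "e = 0" | d where "e = exp_scale (Suc d) f" | "\<And>d. e \<noteq> exp_scale d f"
    by (metis exp_scale_simps(1) not0_implies_Suc)
  then show "mfps_nth (mfps_geom s f) e =
      mfps_nth (1 + mfps_const s * (mfps_monom f * mfps_geom s f)) e"
  proof cases
    case 1
    then show ?thesis using assms mfps_nth_geom_scale[OF assms, of s 0] by simp
  next
    case (2 d)
    then have "e \<noteq> 0"
      using assms by (metis exp_scale_inj exp_scale_simps(1) nat.distinct(1))
    then have "mfps_nth (1 + mfps_const s * (mfps_monom f * mfps_geom s f)) e =
        s * mfps_nth (mfps_monom f * mfps_geom s f) (f + exp_scale d f)"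
      using 2 by simp
    then show ?thesis
      using mfps_nth_geom_scale[OF assms, of s "Suc d"] mfps_nth_geom_scale[OF assms, of s d] 2
      unfolding mfps_nth_monom_mult by simp
  next
    case 3
    then have "e \<noteq> 0"
      by (metis exp_scale_simps(1))
    moreover have "mfps_nth (mfps_monom f * mfps_geom s f) e = 0"
    proof (cases "\<exists>b. e = f + b")
      case True
      then obtain b where b: "e = f + b" by blast
      then have "b \<noteq> exp_scale d f" for d
        using 3[of "Suc d"] by auto
      then show ?thesis
        unfolding b mfps_nth_monom_mult by (rule mfps_nth_geom_eq_0)
    qed (auto intro: mfps_nth_monom_mult_eq_0)
    ultimately show ?thesis
      using mfps_nth_geom_eq_0[OF 3] by simp
  qed
qed

lemma mfps_euler_log:
  assumes "f \<noteq> 0"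
  shows "mfps_euler (mfps_log s f) = mfps_const (of_nat (tdeg f)) * (mfps_geom s f - 1)"
proof (rule mfps_eqI)
  fix e
  show "mfps_nth (mfps_euler (mfps_log s f)) e =
      mfps_nth (mfps_const (of_nat (tdeg f)) * (mfps_geom s f - 1)) e"
  proof (cases "\<exists>d. e = exp_scale d f")
    case True
    then obtain d where d: "e = exp_scale d f" by blast
    show ?thesis
    proof (cases "d = 0")
      case True
      then show ?thesis
        using mfps_nth_geom_scale[OF assms, of s 0] by (simp add: d)
    next
      case False
      then have "e \<noteq> 0"
        using assms by (simp add: d flip: tdeg_eq_0_iff)
      then show ?thesis
        using False mfps_nth_log_scale[OF assms, of d s] mfps_nth_geom_scale[OF assms, of s d]
        by (simp add: d)
    qed
  next
    case False
    then have "mfps_nth (mfps_log s f) e = 0" "mfps_nth (mfps_geom s f) e = 0" "e \<noteq> 0"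
      using mfps_nth_log_eq_0[of e f s] mfps_nth_geom_eq_0[of e f s] exp_scale_simps(1)[of f] by metis+
    then show ?thesis by simp
  qed
qed

lemma mfps_euler_monom: "mfps_euler (mfps_monom f) = mfps_const (of_nat (tdeg f)) * mfps_monom f"
  by (rule mfps_eqI) simp

text \<open>With \<open>x = s x\<^sup>f\<close> and \<open>G = 1 / (1 - x)\<close>, differentiating \<open>G = 1 + x G\<close> gives
  \<open>D G = G \<cdot> |f| x G\<close>, and \<open>|f| x G = |f| (G - 1)\<close> is the derivative of the logarithmic series.\<close>

lemma mfps_exp_log:
  fixes f :: "'v \<Rightarrow>\<^sub>0 nat" and s :: "'a::field_char_0"
  assumes f: "f \<noteq> 0"
  shows "mfps_exp (mfps_log s f) = mfps_geom s f"
proof (rule mfps_exp_eqI)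
  define x where "x = mfps_const s * mfps_monom f"
  define G where "G = mfps_geom s f"
  define c where "c = (mfps_const (of_nat (tdeg f)) :: ('v, 'a) mfps)"
  have G: "G = 1 + x * G"
    using mfps_geom_unfold[OF f, of s] by (simp add: x_def G_def mult.assoc)
  have Dx: "mfps_euler x = c * x"
    by (simp add: x_def c_def mfps_euler_monom mult.left_commute)
  have "mfps_euler G = mfps_euler (1 + x * G)"
    using G by simp
  then have DG: "mfps_euler G - x * mfps_euler G = c * (x * G)"
    by (simp add: mfps_euler_mult Dx diff_eq_eq mult.assoc)
  have inv: "G * (1 - x) = 1"
    using G by (simp add: algebra_simps)
  have "mfps_euler G = G * (1 - x) * mfps_euler G"
    by (simp add: inv)
  also have "\<dots> = G * (mfps_euler G - x * mfps_euler G)"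
    by (simp add: algebra_simps)
  also have "\<dots> = G * (c * (x * G))"
    by (simp only: DG)
  also have "x * G = G - 1"
    using G by (simp add: algebra_simps)
  finally show "mfps_euler (mfps_geom s f) = mfps_geom s f * mfps_euler (mfps_log s f)"
    by (simp add: mfps_euler_log[OF f] G_def c_def)
  show "mfps_nth (mfps_geom s f) 0 = 1"
    using mfps_nth_geom_scale[OF f, of s 0] by simp
qed (rule mfps_nth_log_0[OF f])

lemma mfps_exp_uminus:
  fixes f :: "('v, 'a::field_char_0) mfps"
  assumes "mfps_nth f 0 = 0"
  shows "mfps_exp f * mfps_exp (- f) = 1"
  using mfps_exp_add[of f "- f"] assms by (simp add: mfps_exp_0)

lemma mfps_exp_uminus_log:
  assumes f: "f \<noteq> 0"
  shows "mfps_exp (- mfps_log s f) = 1 - mfps_const s * mfps_monom f"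
proof -
  have inv: "mfps_geom s f * (1 - mfps_const s * mfps_monom f) = 1"
    using mfps_geom_unfold[OF f, of s] by (simp add: algebra_simps)
  have "mfps_geom s f * mfps_exp (- mfps_log s f) = 1"
    using mfps_exp_uminus[OF mfps_nth_log_0[OF f, of s]] by (simp add: mfps_exp_log[OF f])
  then have "mfps_exp (- mfps_log s f) * (mfps_geom s f * (1 - mfps_const s * mfps_monom f)) =
      1 - mfps_const s * mfps_monom f"
    by (simp only: mult.assoc[symmetric] mult.commute[of "mfps_exp _"] mult_1)
  with inv show ?thesis by simp
qed


definition int_series :: "'v set \<Rightarrow> ('v, 'a::ring_char_0) mfps set" where
  "int_series V = {F. \<forall>e. mfps_nth F e \<in> \<int> \<and>
     (mfps_nth F e \<noteq> 0 \<longrightarrow> Poly_Mapping.keys e \<subseteq> V)}"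

lemma int_series_1: "1 \<in> int_series V"
  by (simp add: int_series_def)

lemma int_series_mult:
  fixes F G :: "('v, 'a::{comm_ring_1, ring_char_0}) mfps"
  assumes F: "F \<in> int_series V" and G: "G \<in> int_series V"
  shows "F * G \<in> int_series V"
  unfolding int_series_def mem_Collect_eq
proof (intro allI conjI impI)
  fix e
  show "mfps_nth (F * G) e \<in> \<int>"
    using assms by (auto simp: mfps_nth_mult int_series_def intro!: Ints_sum Ints_mult)
  assume "mfps_nth (F * G) e \<noteq> 0"
  then obtain a b where "a + b = e" "mfps_nth F a * mfps_nth G b \<noteq> 0"
    by (auto simp: mfps_nth_mult splits_def elim!: sum.not_neutral_contains_not_neutral)
  then have "mfps_nth F a \<noteq> 0" "mfps_nth G b \<noteq> 0"
    by auto
  then have "Poly_Mapping.keys a \<subseteq> V" "Poly_Mapping.keys b \<subseteq> V"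
    using F G by (auto simp: int_series_def)
  with \<open>a + b = e\<close> show "Poly_Mapping.keys e \<subseteq> V"
    using Poly_Mapping.keys_add[of a b] by blast
qed

lemma int_series_power:
  fixes F :: "('v, 'a::{comm_ring_1, ring_char_0}) mfps"
  shows "F \<in> int_series V \<Longrightarrow> F ^ k \<in> int_series V"
  by (induction k) (simp_all add: int_series_1 int_series_mult)

lemma int_series_prod:
  fixes F :: "'i \<Rightarrow> ('v, 'a::{comm_ring_1, ring_char_0}) mfps"
  shows "(\<And>x. x \<in> A \<Longrightarrow> F x \<in> int_series V) \<Longrightarrow> prod F A \<in> int_series V"
  by (induction A rule: infinite_finite_induct) (simp_all add: int_series_1 int_series_mult)

lemma mfps_exp_of_nat_mult:
  fixes f :: "('v, 'a::field_char_0) mfps"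
  assumes "mfps_nth f 0 = 0"
  shows "mfps_exp (mfps_const (of_nat k) * f) = mfps_exp f ^ k"
proof (induction k)
  case (Suc k)
  have "mfps_const (of_nat (Suc k)) * f = f + mfps_const (of_nat k) * f"
    by (rule mfps_eqI) (simp add: distrib_right)
  then show ?case
    using Suc assms by (simp add: mfps_exp_add)
qed (simp add: mfps_exp_0 mfps_const_arith)

lemma mfps_exp_sum:
  fixes f :: "'i \<Rightarrow> ('v, 'a::field_char_0) mfps"
  shows "finite A \<Longrightarrow> (\<And>x. x \<in> A \<Longrightarrow> mfps_nth (f x) 0 = 0) \<Longrightarrow>
    mfps_exp (sum f A) = (\<Prod>x\<in>A. mfps_exp (f x))"
  by (induction A rule: finite_induct) (simp_all add: mfps_exp_0 mfps_exp_add)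

lemma int_series_exp_log:
  fixes s :: "'a::field_char_0"
  assumes f: "f \<noteq> 0" "Poly_Mapping.keys f \<subseteq> V" and s: "s \<in> \<int>"
  shows "mfps_exp (mfps_const (of_int b) * mfps_log s f) \<in> int_series V"
proof (cases "b \<ge> 0")
  case True
  have "mfps_geom s f \<in> int_series V"
    unfolding int_series_def mem_Collect_eq
  proof (intro allI conjI impI)
    fix e
    show "mfps_nth (mfps_geom s f) e \<in> \<int>"
      using s by (auto simp: mfps_geom_def intro!: Ints_sum Ints_power)
    assume "mfps_nth (mfps_geom s f) e \<noteq> 0"
    then obtain d where "e = exp_scale d f"
      using mfps_nth_geom_eq_0 by metis
    then show "Poly_Mapping.keys e \<subseteq> V"
      using keys_exp_scale[of d f] f by auto
  qed
  moreover have "mfps_const (of_int b) * mfps_log s f = mfps_const (of_nat (nat b)) * mfps_log s f"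
    using True by (metis of_int_of_nat_eq nat_0_le)
  ultimately show ?thesis
    using f by (simp add: mfps_exp_of_nat_mult mfps_nth_log_0 mfps_exp_log int_series_power)
next
  case False
  have "1 - mfps_const s * mfps_monom f \<in> int_series V"
    using f s by (auto simp: int_series_def)
  moreover have "mfps_const (of_int b) * mfps_log s f =
      mfps_const (of_nat (nat (- b))) * (- mfps_log s f)"
    using False by (intro mfps_eqI) simp
  moreover have "mfps_exp (mfps_const (of_nat (nat (- b))) * (- mfps_log s f)) =
      (1 - mfps_const s * mfps_monom f) ^ nat (- b)"
    by (subst mfps_exp_of_nat_mult) (simp_all add: mfps_nth_log_0 mfps_exp_uminus_log f)
  ultimately show ?thesis
    by (simp only: int_series_power)
qed

text \<open>If \<open>g = - \<Sum>\<^sub>f b\<^sub>f log (1 - s\<^sub>f x\<^sup>f)\<close> with integers \<open>b\<^sub>f\<close> and \<open>s\<^sub>f\<close>, then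
  \<open>exp g = \<Prod>\<^sub>f (1 - s\<^sub>f x\<^sup>f)\<^bsup>-b\<^sub>f\<^esup>\<close>, all of whose factors are integral.\<close>

theorem int_series_exp:
  fixes g :: "('v, 'a::field_char_0) mfps" and b s :: "('v \<Rightarrow>\<^sub>0 nat) \<Rightarrow> int"
  assumes supp: "\<And>f. b f \<noteq> 0 \<Longrightarrow> Poly_Mapping.keys f \<subseteq> V"
    and g: "\<And>e. mfps_nth g e =
      (\<Sum>(d, f)\<in>{(d, f). d > 0 \<and> f \<noteq> 0 \<and> exp_scale d f = e}. of_int (b f) * (of_int (s f) ^ d / of_nat d))"
  shows "mfps_exp g \<in> int_series V"
proof -
  have g0: "mfps_nth g 0 = 0"
    unfolding g by (rule sum.neutral) (auto simp flip: tdeg_eq_0_iff)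
  have "\<exists>F\<in>int_series V. mfps_nth (mfps_exp g) e = mfps_nth F e" for e
  proof -
    \<comment> \<open>The coefficient at \<open>e\<close> sees only the finitely many factors with \<open>f \<le> e\<close>.\<close>
    define T where "T = fst ` splits e - {0}"
    define L where "L f = mfps_const (of_int (b f)) * mfps_log (of_int (s f) :: 'a) f" for f
    have [simp]: "finite T" by (simp add: T_def)
    have "mfps_nth g a = mfps_nth (sum L T) a" if "a + c = e" for a c
    proof -
      have "mfps_nth (sum L T) a =
          (\<Sum>f\<in>T. \<Sum>d\<in>{d. d > 0 \<and> exp_scale d f = a}. of_int (b f) * (of_int (s f) ^ d / of_nat d))"
        by (simp add: L_def mfps_log_def sum_distrib_left)
      also have "\<dots> = (\<Sum>(f, d)\<in>Sigma T (\<lambda>f. {d. d > 0 \<and> exp_scale d f = a}).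
          of_int (b f) * (of_int (s f) ^ d / of_nat d))"
        by (rule sum.Sigma) (auto simp: T_def finite_exp_scale_eq)
      also have "\<dots> = (\<Sum>(d, f)\<in>{(d, f). d > 0 \<and> f \<noteq> 0 \<and> exp_scale d f = a}.
          of_int (b f) * (of_int (s f) ^ d / of_nat d))"
      proof (rule sum.reindex_bij_witness[where i = prod.swap and j = prod.swap])
        fix x assume "x \<in> {(d, f). d > 0 \<and> f \<noteq> 0 \<and> exp_scale d f = a}"
        then obtain d' f where "x = (d', f)" "d' > 0" and f: "f \<noteq> 0" "exp_scale d' f = a"
          by auto
        then obtain d where x: "x = (Suc d, f)" "exp_scale (Suc d) f = a"
          using gr0_implies_Suc by blast
        then have "(f, exp_scale d f + c) \<in> splits e"
          using that by (auto simp: splits_def add.assoc)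
        with x f(1) show "prod.swap x \<in> Sigma T (\<lambda>f. {d. d > 0 \<and> exp_scale d f = a})"
          by (force simp: T_def)
      qed (auto simp: T_def)
      finally show ?thesis by (simp add: g)
    qed
    then have "mfps_nth (mfps_exp g) e = mfps_nth (mfps_exp (sum L T)) e"
      using g0 by (intro mfps_exp_cong)
    also have "mfps_exp (sum L T) = (\<Prod>f\<in>T. mfps_exp (L f))"
      by (rule mfps_exp_sum) (auto simp: L_def T_def mfps_nth_log_0)
    finally have "mfps_nth (mfps_exp g) e = mfps_nth (\<Prod>f\<in>T. mfps_exp (L f)) e" .
    moreover have "mfps_exp (L f) \<in> int_series V" if "f \<in> T" for f
    proof (cases "b f = 0")
      case True
      then show ?thesis by (simp add: L_def mfps_const_arith mfps_exp_0 int_series_1)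
    next
      case False
      then show ?thesis
        using that supp[of f] unfolding L_def by (intro int_series_exp_log) (auto simp: T_def)
    qed
    ultimately show ?thesis
      using int_series_prod[of T "\<lambda>f. mfps_exp (L f)" V] by auto
  qed
  then obtain F where F: "\<And>e. F e \<in> int_series V" "\<And>e. mfps_nth (mfps_exp g) e = mfps_nth (F e) e"
    by metis
  show ?thesis
    unfolding int_series_def mem_Collect_eq
  proof
    fix e
    show "mfps_nth (mfps_exp g) e \<in> \<int> \<and>
        (mfps_nth (mfps_exp g) e \<noteq> 0 \<longrightarrow> Poly_Mapping.keys e \<subseteq> V)"
      using F(1)[of e] by (simp add: F(2) int_series_def)
  qed
qed

section \<open>Reduction to rays of exponents\<close>

text \<open>Every non-zero exponent is in a unique way a positive multiple of a primitive one, that is, of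
  one of content \<open>1\<close>; the multiples of a primitive exponent form a ray.\<close>

definition exp_content :: "('v \<Rightarrow>\<^sub>0 nat) \<Rightarrow> nat" where
  "exp_content e = Gcd (range (Poly_Mapping.lookup e))"

definition exp_primitive :: "('v \<Rightarrow>\<^sub>0 nat) \<Rightarrow> ('v \<Rightarrow>\<^sub>0 nat)" where
  "exp_primitive e = Poly_Mapping.map (\<lambda>k. k div exp_content e) e"

lemma exp_content_eq_0_iff [simp]: "exp_content e = 0 \<longleftrightarrow> e = 0"
  by (auto simp: exp_content_def poly_mapping_eq_iff fun_eq_iff)

lemma exp_content_scale [simp]: "exp_content (exp_scale d e) = d * exp_content e"
  using Gcd_mult[of d "range (Poly_Mapping.lookup e)"]
  by (simp add: exp_content_def image_image)

lemma exp_scale_content_primitive: "exp_scale (exp_content e) (exp_primitive e) = e"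
proof (rule exp_scale_eqI)
  fix x
  have "exp_content e dvd Poly_Mapping.lookup e x"
    unfolding exp_content_def by (rule Gcd_dvd) simp
  then show "Poly_Mapping.lookup e x = exp_content e * Poly_Mapping.lookup (exp_primitive e) x"
    by (simp add: exp_primitive_def map.rep_eq when_def)
qed

lemma exp_content_primitive:
  assumes "e \<noteq> 0"
  shows "exp_content (exp_primitive e) = 1"
proof -
  have "exp_content e = exp_content e * exp_content (exp_primitive e)"
    by (metis exp_content_scale exp_scale_content_primitive)
  with assms show ?thesis by simp
qed

lemma exp_scale_right_inj:
  assumes "d > 0"
  shows "exp_scale d e = exp_scale d f \<longleftrightarrow> e = f"
  using assms by (auto simp: poly_mapping_eq_iff fun_eq_iff)

lemma exp_scale_exp_scale: "exp_scale c (exp_scale d e) = exp_scale (c * d) e"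
  by (rule exp_scale_eqI) simp

lemma exp_primitive_scale:
  assumes "exp_content e = 1" "d > 0"
  shows "exp_primitive (exp_scale d e) = e"
  using exp_scale_content_primitive[of "exp_scale d e"] assms
  by (simp add: exp_scale_right_inj)

lemma keys_exp_scale_eq: "d > 0 \<Longrightarrow> Poly_Mapping.keys (exp_scale d f) = Poly_Mapping.keys f"
  by (auto simp: in_keys_iff)

text \<open>On the ray of a primitive \<open>e\<close>, the exponents \<open>f = q e\<close> that contribute to \<open>m e\<close> are those with
  \<open>q\<close> dividing \<open>m\<close>. With \<open>s\<^sub>f = \<sigma>\<^sup>q\<close> the power \<open>s\<^sub>f\<^bsup>m/q\<^esup> = \<sigma>\<^sup>m\<close> is the same for all of them, so the
  criterion becomes one on divisor sums, and signs that are multiplicative along the ray are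
  harmless.\<close>

theorem int_series_exp_rays:
  fixes g :: "('v, 'a::field_char_0) mfps"
  assumes g0: "mfps_nth g 0 = 0"
    and supp: "\<And>e. mfps_nth g e \<noteq> 0 \<Longrightarrow> Poly_Mapping.keys e \<subseteq> V"
    and rays: "\<And>e. exp_content e = 1 \<Longrightarrow> Poly_Mapping.keys e \<subseteq> V \<Longrightarrow>
      \<exists>\<sigma> b. \<forall>m>0. mfps_nth g (exp_scale m e) =
        of_int (\<sigma> ^ m * (\<Sum>q | q dvd m. int q * b q)) / of_nat m"
  shows "mfps_exp g \<in> int_series V"
proof -
  obtain \<sigma> b where ray: "\<And>e m. exp_content e = 1 \<Longrightarrow> Poly_Mapping.keys e \<subseteq> V \<Longrightarrow> m > 0 \<Longrightarrow>
      mfps_nth g (exp_scale m e) =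
        of_int (\<sigma> e ^ m * (\<Sum>q | q dvd m. int q * b e q)) / of_nat m"
    using rays by metis
  define B where "B f = (if Poly_Mapping.keys f \<subseteq> V then b (exp_primitive f) (exp_content f) else 0)" for f
  define S where "S f = \<sigma> (exp_primitive f) ^ exp_content f" for f
  show ?thesis
  proof (rule int_series_exp)
    show "Poly_Mapping.keys f \<subseteq> V" if "B f \<noteq> 0" for f
      using that by (auto simp: B_def split: if_splits)
    fix e :: "'v \<Rightarrow>\<^sub>0 nat"
    let ?D = "{(d, f). d > 0 \<and> f \<noteq> 0 \<and> exp_scale d f = e}"
    show "mfps_nth g e = (\<Sum>(d, f)\<in>?D. of_int (B f) * (of_int (S f) ^ d / of_nat d))"
    proof (cases "e \<noteq> 0 \<and> Poly_Mapping.keys e \<subseteq> V")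
      case True
      define m where "m = exp_content e"
      define p where "p = exp_primitive e"
      have e: "e = exp_scale m p" and p: "exp_content p = 1" and m: "m \<noteq> 0"
        using True exp_content_primitive[of e]
        by (simp_all add: m_def p_def exp_scale_content_primitive)
      then have m: "m > 0" by simp
      have pV: "Poly_Mapping.keys p \<subseteq> V"
        using True m by (simp add: e keys_exp_scale_eq)
      have "(\<Sum>(d, f)\<in>?D. of_int (B f) * (of_int (S f) ^ d / of_nat d)) =
          (\<Sum>q | q dvd m. of_int (\<sigma> p ^ m * (int q * b p q)) / (of_nat m :: 'a))"
      proof (rule sum.reindex_bij_witness[where i = "\<lambda>q. (m div q, exp_scale q p)" and j = "\<lambda>(d, f). exp_content f"])
        fix x assume "x \<in> ?D"
        then obtain d f where x: "x = (d, f)" "d > 0" "f \<noteq> 0" "exp_scale d f = exp_scale m p"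
          by (auto simp: e)
        define q where "q = exp_content f"
        have "q \<noteq> 0" using x by (simp add: q_def)
        then have q: "q > 0" by simp
        have "d * q = m"
          using arg_cong[OF x(4), of exp_content] p by (simp add: q_def)
        moreover have "exp_scale d f = exp_scale d (exp_scale q p)"
          by (simp add: x(4) exp_scale_exp_scale \<open>d * q = m\<close>)
        then have f: "f = exp_scale q p"
          using x by (simp add: exp_scale_right_inj)
        ultimately show "(m div (case x of (d, f) \<Rightarrow> exp_content f), exp_scale (case x of (d, f) \<Rightarrow> exp_content f) p) = x"
          "(case x of (d, f) \<Rightarrow> exp_content f) \<in> {q. q dvd m}"
          using q p by (auto simp: x(1) simp flip: q_def)
        have "B f = b p q" "S f = \<sigma> p ^ q"
          using f p q pV by (simp_all add: B_def S_def exp_primitive_scale keys_exp_scale_eq)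
        then show "of_int (\<sigma> p ^ m * (int (case x of (d, f) \<Rightarrow> exp_content f) *
              b p (case x of (d, f) \<Rightarrow> exp_content f))) / (of_nat m :: 'a) =
            (case x of (d, f) \<Rightarrow> of_int (B f) * (of_int (S f) ^ d / of_nat d))"
          using q x(2) by (simp add: x(1) flip: q_def \<open>d * q = m\<close>)
            (simp add: field_simps flip: power_mult)
      next
        fix q assume "q \<in> {q. q dvd m}"
        then show "(case (m div q, exp_scale q p) of (d, f) \<Rightarrow> exp_content f) = q"
          "(m div q, exp_scale q p) \<in> ?D"
          using m p by (auto simp: e exp_scale_exp_scale dvd_def simp flip: exp_content_eq_0_iff)
      qed
      also have "\<dots> = of_int (\<sigma> p ^ m * (\<Sum>q | q dvd m. int q * b p q)) / of_nat m"
        by (simp add: sum_distrib_left sum_divide_distrib)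
      finally show ?thesis
        using ray[OF p pV m] by (simp add: e)
    next
      case False
      have "B f = 0" if "(d, f) \<in> ?D" for d f
        using that False keys_exp_scale_eq[of d f] by (auto simp: B_def simp flip: exp_content_eq_0_iff)
      then have "(\<Sum>(d, f)\<in>?D. of_int (B f) * (of_int (S f) ^ d / of_nat d)) = (0 :: 'a)"
        by (intro sum.neutral) auto
      moreover have "mfps_nth g e = 0"
        using False supp[of e] g0 by auto
      ultimately show ?thesis by simp
    qed
  qed
qed

section \<open>Divisor sums and multinomial coefficients\<close>

lemma int_dvd_of_prime_powers:
  fixes m :: nat and x :: int
  assumes "m > 0" "\<And>p r. prime p \<Longrightarrow> r > 0 \<Longrightarrow> p ^ r dvd m \<Longrightarrow> int (p ^ r) dvd x"
  shows "int m dvd x"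
proof (cases "x = 0")
  case False
  have "m dvd nat \<bar>x\<bar>"
  proof (rule multiplicity_le_imp_dvd)
    fix p :: nat assume p: "prime p"
    have "p ^ multiplicity p m dvd nat \<bar>x\<bar>"
    proof (cases "multiplicity p m = 0")
      case False
      then have "int (p ^ multiplicity p m) dvd x"
        using p by (intro assms) (auto simp: multiplicity_dvd)
      then show ?thesis by (metis int_dvd_int_iff dvd_abs_iff int_nat_eq abs_ge_zero nat_0_le)
    qed simp
    then show "multiplicity p m \<le> multiplicity p (nat \<bar>x\<bar>)"
      using p False by (intro multiplicity_geI) (auto simp: prime_gt_0_nat dest: prime_gt_1_nat)
  qed (use assms in auto)
  then show ?thesis by (simp add: nat_dvd_iff int_dvd_int_iff flip: dvd_nat_abs_iff)
qed simp

text \<open>Solves \<open>c m = \<Sum>\<^bsub>d | m\<^esub> d b\<^sub>d\<close> recursively for \<open>b\<close>; the integer division is exact for the sequences of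
  interest. If \<open>c\<close> comes from the multinomial coefficients below, with coprime \<open>k\<^sub>j\<close>, then \<open>b\<^sub>d\<close> is the number of
  aperiodic necklaces with \<open>d k\<^sub>j\<close> beads of colour \<open>j\<close>.\<close>

function necklace :: "(nat \<Rightarrow> int) \<Rightarrow> nat \<Rightarrow> int" where
  "necklace c m = (c m - (\<Sum>d | d dvd m \<and> d < m. int d * necklace c d)) div int m"
  by auto
termination by (relation "Wellfounded.measure snd") auto

declare necklace.simps [simp del]

text \<open>Let \<open>p\<^sup>r\<close> divide \<open>m\<close>. A divisor \<open>d\<close> of \<open>m\<close> that does not divide \<open>m/p\<close> is a multiple of \<open>p\<^sup>r\<close>, so
  modulo \<open>p\<^sup>r\<close> the sum over the proper divisors of \<open>m\<close> reduces to the sum over the divisors of \<open>m/p\<close>, which is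
  \<open>c (m/p)\<close> by induction. Congruence of \<open>c m\<close> and \<open>c (m/p)\<close> then makes the division in the
  recursion exact at every prime power.\<close>

lemma sum_divisors_necklace:
  fixes c :: "nat \<Rightarrow> int"
  assumes c: "\<And>p r m. prime p \<Longrightarrow> r > 0 \<Longrightarrow> m > 0 \<Longrightarrow> p ^ r dvd m \<Longrightarrow> [c m = c (m div p)] (mod int (p ^ r))"
  shows "m > 0 \<Longrightarrow> (\<Sum>d | d dvd m. int d * necklace c d) = c m"
proof (induction m rule: less_induct)
  case (less m)
  let ?t = "\<lambda>d. int d * necklace c d"
  have fin: "finite {d. d dvd m}"
    using less.prems by simp
  have "int m dvd c m - (\<Sum>d | d dvd m \<and> d < m. ?t d)"
  proof (rule int_dvd_of_prime_powers)
    fix p r :: nat assume p: "prime p" "r > 0" "p ^ r dvd m"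
    then have "p dvd m" by (meson dvd_power dvd_trans)
    then obtain m' where m': "m = p * m'" by blast
    with less.prems p have pos: "m' > 0" "m' < m" "m div p = m'"
      by (auto dest: prime_gt_1_nat)
    have "d dvd m \<and> d < m" if "d dvd m'" for d
      using dvd_imp_le[OF that pos(1)] that pos(2) m' by (metis dvd_mult le_less_trans)
    then have split: "{d. d dvd m \<and> d < m} = {d. d dvd m'} \<union> {d. d dvd m \<and> d < m \<and> \<not> d dvd m'}"
      by blast
    have "(\<Sum>d | d dvd m \<and> d < m. ?t d) = (\<Sum>d | d dvd m'. ?t d) + (\<Sum>d | d dvd m \<and> d < m \<and> \<not> d dvd m'. ?t d)"
      unfolding split by (rule sum.union_disjoint) (use pos fin in auto)
    moreover have "(\<Sum>d | d dvd m'. ?t d) = c m'"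
      using less.IH pos by blast
    moreover have "int (p ^ r) dvd (\<Sum>d | d dvd m \<and> d < m \<and> \<not> d dvd m'. ?t d)"
    proof (rule dvd_sum, clarify)
      fix d assume d: "d dvd m" "\<not> d dvd m'"
      then obtain e where e: "m = d * e" by blast
      have "\<not> p dvd e"
      proof
        assume "p dvd e"
        then obtain e' where "e = p * e'" by blast
        with e m' p(1) have "m' = d * e'" by (auto simp: prime_gt_0_nat)
        with d show False by simp
      qed
      then have "coprime (p ^ r) e"
        using p(1) by (simp add: prime_imp_coprime)
      with p(3) e have "p ^ r dvd d"
        by (simp add: coprime_dvd_mult_left_iff)
      then show "int (p ^ r) dvd ?t d"
        by (meson dvd_mult2 int_dvd_int_iff)
    qed
    moreover have "int (p ^ r) dvd c m - c m'"
      using c[OF p(1,2) less.prems p(3)] pos by (simp add: cong_iff_dvd_diff)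
    ultimately show "int (p ^ r) dvd c m - (\<Sum>d | d dvd m \<and> d < m. ?t d)"
      by (simp only: diff_diff_add[symmetric]) (rule dvd_diff)
  qed (use less.prems in simp)
  then have "?t m = c m - (\<Sum>d | d dvd m \<and> d < m. ?t d)"
    by (subst necklace.simps) simp
  moreover have "{d. d dvd m} = insert m {d. d dvd m \<and> d < m}"
    using less.prems by (auto dest: dvd_imp_le)
  ultimately show ?case
    using fin by simp
qed


lemma prod_fact_dvd_fact_sum:
  fixes k :: "'i \<Rightarrow> nat"
  shows "finite J \<Longrightarrow> (\<Prod>j\<in>J. fact (k j)) dvd (fact (\<Sum>j\<in>J. k j) :: nat)"
proof (induction J rule: finite_induct)
  case (insert x J)
  then have "(\<Prod>j\<in>insert x J. fact (k j)) dvd (fact (k x) * fact (\<Sum>j\<in>J. k j) :: nat)"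
    by simp
  also have "\<dots> dvd fact (k x + (\<Sum>j\<in>J. k j))"
    by (rule fact_fact_dvd_fact)
  finally show ?case using insert by simp
qed simp

text \<open>With \<open>K = \<Sum>\<^sub>j k\<^sub>j\<close> and \<open>k\<^sub>j > 0\<close>, the quotient \<open>k\<^sub>j (K - 1)! / \<Prod>\<^sub>i k\<^sub>i!\<close> is again a multinomial coefficient, with
  \<open>k\<^sub>j\<close> lowered by one. Hence the denominator divides \<open>k\<^sub>j (K - 1)!\<close> for every \<open>j\<close>.\<close>

lemma prod_fact_dvd_Gcd_mult_fact:
  fixes k :: "'i \<Rightarrow> nat"
  assumes J: "finite J"
  shows "(\<Prod>j\<in>J. fact (k j)) dvd Gcd (k ` J) * (fact ((\<Sum>j\<in>J. k j) - 1) :: nat)"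
proof -
  let ?P = "\<Prod>j\<in>J. fact (k j) :: nat" and ?F = "fact ((\<Sum>j\<in>J. k j) - 1) :: nat"
  have *: "?P dvd ?F * k j" if j: "j \<in> J" for j
  proof (cases "k j")
    case (Suc r)
    let ?S = "\<Sum>i\<in>J - {j}. k i"
    have "(\<Sum>j\<in>J. k j) = k j + ?S" "?P = fact (k j) * (\<Prod>i\<in>J - {j}. fact (k i))"
      using J j by (simp_all add: sum.remove prod.remove)
    moreover have "fact r * (\<Prod>i\<in>J - {j}. fact (k i)) dvd (fact (r + ?S) :: nat)"
      using prod_fact_dvd_fact_sum[of "J - {j}" k] J
      by (meson dvd_trans fact_fact_dvd_fact finite_Diff mult_dvd_mono dvd_refl)
    then have "k j * (fact r * (\<Prod>i\<in>J - {j}. fact (k i))) dvd k j * (fact (r + ?S) :: nat)"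
      by (rule mult_dvd_mono[OF dvd_refl])
    ultimately show ?thesis
      using Suc by (simp add: mult_ac del: mult_Suc mult_Suc_right)
  qed simp
  have "?P dvd Gcd ((*) ?F ` k ` J)"
    using * by (auto intro!: Gcd_greatest)
  then show ?thesis unfolding Gcd_mult by (simp add: mult.commute)
qed

text \<open>The part of \<open>n!\<close> made of the factors prime to \<open>p\<close>. If \<open>p\<close> divides \<open>q\<close>, then
  modulo \<open>q\<close> it is the same on each block of \<open>q\<close> consecutive
  integers, which makes its value at \<open>q s\<close> congruent to an \<open>s\<close>-th power.\<close>

definition prime_free_fact :: "nat \<Rightarrow> nat \<Rightarrow> nat" where
  "prime_free_fact p n = (\<Prod>i | i \<in> {1..n} \<and> \<not> p dvd i. i)"

lemma fact_mult_prime_free: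
  assumes p: "p > 0"
  shows "fact (p * n) = p ^ n * fact n * prime_free_fact p (p * n)"
proof -
  have "fact (p * n) = (\<Prod>i | i \<in> {1..p * n} \<and> p dvd i. i) * (\<Prod>i | i \<in> {1..p * n} \<and> \<not> p dvd i. i)"
    unfolding fact_prod of_nat_id by (subst prod.union_disjoint[symmetric]) (auto intro!: prod.cong)
  also have "{i. i \<in> {1..p * n} \<and> p dvd i} = (*) p ` {1..n}"
    using p by (auto elim!: dvdE)
  also have "prod (\<lambda>i. i) ((*) p ` {1..n}) = (\<Prod>i\<in>{1..n}. p * i)"
    using p by (subst prod.reindex) (auto simp: inj_on_def)
  also have "\<dots> = p ^ n * fact n"
    by (simp add: prod.distrib fact_prod)
  finally show ?thesis by (simp add: prime_free_fact_def)
qed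

lemma prime_free_fact_cong:
  assumes q: "p dvd q"
  shows "[prime_free_fact p (q * s) = prime_free_fact p q ^ s] (mod q)"
proof (induction s)
  case (Suc s)
  have "{i. i \<in> {1..q * Suc s} \<and> \<not> p dvd i} =
      {i. i \<in> {1..q * s} \<and> \<not> p dvd i} \<union> (+) (q * s) ` {i. i \<in> {1..q} \<and> \<not> p dvd i}"
    (is "?A = ?B \<union> ?C")
  proof
    show "?A \<subseteq> ?B \<union> ?C"
    proof
      fix i assume i: "i \<in> ?A"
      show "i \<in> ?B \<union> ?C"
      proof (cases "i \<le> q * s")
        case False
        then have "i = q * s + (i - q * s)" by simp
        moreover have "\<not> p dvd i - q * s"
          using i q False by (metis \<open>i = q * s + (i - q * s)\<close> dvd_add dvd_mult2 mem_Collect_eq)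
        ultimately show ?thesis using i False by (auto simp: image_iff intro!: exI[of _ "i - q * s"])
      qed (use i in auto)
    qed
    show "?B \<union> ?C \<subseteq> ?A"
      using q by (auto simp: dvd_add_right_iff)
  qed
  then have "prime_free_fact p (q * Suc s) = prod (\<lambda>i. i) (?B \<union> ?C)"
    by (simp only: prime_free_fact_def)
  also have "\<dots> = prime_free_fact p (q * s) * prod (\<lambda>i. i) ?C"
    unfolding prime_free_fact_def by (rule prod.union_disjoint) auto
  also have "prod (\<lambda>i. i) ?C = (\<Prod>i | i \<in> {1..q} \<and> \<not> p dvd i. q * s + i)"
    by (subst prod.reindex) (auto simp: inj_on_def)
  finally have eq: "prime_free_fact p (q * Suc s) =
      prime_free_fact p (q * s) * (\<Prod>i | i \<in> {1..q} \<and> \<not> p dvd i. q * s + i)" .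
  have "[(\<Prod>i | i \<in> {1..q} \<and> \<not> p dvd i. q * s + i) = prime_free_fact p q] (mod q)"
    unfolding prime_free_fact_def by (rule cong_prod) (simp add: cong_def)
  then have "[prime_free_fact p (q * Suc s) = prime_free_fact p q ^ s * prime_free_fact p q] (mod q)"
    unfolding eq using Suc by (rule cong_mult[rotated])
  then show ?case by (simp add: mult.commute)
qed (simp add: prime_free_fact_def)

lemma coprime_prime_free_fact:
  "prime p \<Longrightarrow> coprime (prime_free_fact p n) (p ^ r)"
  unfolding prime_free_fact_def
  by (intro prod_coprime_left coprime_power_right_iff[THEN iffD2] disjI1)
    (metis (no_types, lifting) coprime_commute mem_Collect_eq prime_imp_coprime)

text \<open>With \<open>K = \<Sum>\<^sub>j k\<^sub>j > 0\<close> this is \<open>1/K\<close> times the multinomial coefficient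
  \<open>(m K)! / \<Prod>\<^sub>j (m k\<^sub>j)!\<close>, for \<open>m > 0\<close>. The factor \<open>m\<close> is what makes the division exact when
  the \<open>k\<^sub>j\<close> have greatest common divisor \<open>1\<close>.\<close>

definition cyclic_multinomial :: "('i \<Rightarrow> nat) \<Rightarrow> 'i set \<Rightarrow> nat \<Rightarrow> nat" where
  "cyclic_multinomial k J m =
     m * fact (m * (\<Sum>j\<in>J. k j) - 1) div (\<Prod>j\<in>J. fact (m * k j))"

lemma cyclic_multinomial_mult_prod:
  assumes J: "finite J" "Gcd (k ` J) = 1"
  shows "cyclic_multinomial k J m * (\<Prod>j\<in>J. fact (m * k j)) = m * fact (m * (\<Sum>j\<in>J. k j) - 1)"
proof -
  have "Gcd ((\<lambda>j. m * k j) ` J) = m"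
    using Gcd_mult[of m "k ` J"] J by (simp add: image_image)
  then have "(\<Prod>j\<in>J. fact (m * k j)) dvd m * (fact (m * (\<Sum>j\<in>J. k j) - 1) :: nat)"
    using prod_fact_dvd_Gcd_mult_fact[OF J(1), of "\<lambda>j. m * k j"] by (simp add: sum_distrib_left)
  then show ?thesis
    by (simp add: cyclic_multinomial_def)
qed

lemma cyclic_multinomial_mult:
  assumes J: "finite J" "Gcd (k ` J) = 1" and m: "m > 0" and K: "(\<Sum>j\<in>J. k j) > 0"
  shows "cyclic_multinomial k J m * (\<Sum>j\<in>J. k j) * (\<Prod>j\<in>J. fact (m * k j)) =
    fact (m * (\<Sum>j\<in>J. k j))"
proof -
  let ?K = "\<Sum>j\<in>J. k j"
  have "cyclic_multinomial k J m * ?K * (\<Prod>j\<in>J. fact (m * k j)) = (m * ?K) * fact (m * ?K - 1)"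
    using cyclic_multinomial_mult_prod[OF J, of m] by (simp add: mult_ac)
  then show ?thesis
    using m K fact_reduce[of "m * ?K", where 'a = nat] by simp
qed

text \<open>Splitting each factorial \<open>(p a)!\<close> as \<open>p\<^sup>a a!\<close> times its part prime to \<open>p\<close>, the powers of \<open>p\<close> cancel and
  \<open>c\<^sub>m V = c\<^bsub>m/p\<^esub> U\<close> remains, with \<open>U\<close> and \<open>V\<close> prime to \<open>p\<close>. By blocks of length \<open>p\<^sup>r\<close>, both \<open>U\<close>
  and \<open>V\<close> are congruent to the same power of one unit, since \<open>\<Sum>\<^sub>j k\<^sub>j = K\<close>.\<close>

lemma cyclic_multinomial_cong:
  assumes J: "finite J" "Gcd (k ` J) = 1" and K: "(\<Sum>j\<in>J. k j) > 0"
    and p: "prime p" "r > 0" and m: "m > 0" "p ^ r dvd m"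
  shows "[cyclic_multinomial k J m = cyclic_multinomial k J (m div p)] (mod p ^ r)"
proof -
  let ?K = "\<Sum>j\<in>J. k j"
  obtain t where t: "m = p ^ r * t" using m(2) by blast
  define m' where "m' = m div p"
  have pdvd: "p dvd p ^ r" using p(2) by (rule dvd_power[OF disjI1])
  then have m': "m = p * m'" using t by (simp add: m'_def)
  have pos: "p > 0" "m' > 0" using m' m by auto
  let ?c = "cyclic_multinomial k J m" and ?c' = "cyclic_multinomial k J m'"
  let ?P = "\<Prod>j\<in>J. fact (m' * k j) :: nat"
  let ?V = "\<Prod>j\<in>J. prime_free_fact p (m * k j)"
  have "(\<Prod>j\<in>J. fact (m * k j)) = (\<Prod>j\<in>J. p ^ (m' * k j) * fact (m' * k j) * prime_free_fact p (m * k j))"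
    using fact_mult_prime_free[OF pos(1)] by (intro prod.cong) (simp_all add: m' mult.assoc)
  also have "\<dots> = p ^ (m' * ?K) * ?P * ?V"
    by (simp add: prod.distrib sum_distrib_left flip: power_sum)
  finally have "?c * ?K * (p ^ (m' * ?K) * ?P * ?V) = fact (m * ?K)"
    using cyclic_multinomial_mult[OF J m(1) K] by simp
  also have "\<dots> = p ^ (m' * ?K) * (?c' * ?K * ?P) * prime_free_fact p (m * ?K)"
    using fact_mult_prime_free[OF pos(1), of "m' * ?K"] cyclic_multinomial_mult[OF J pos(2) K]
    by (simp add: m' mult.assoc)
  finally have cancel: "(?K * p ^ (m' * ?K) * ?P) * (?c * ?V) =
      (?K * p ^ (m' * ?K) * ?P) * (?c' * prime_free_fact p (m * ?K))"
    by (simp only: mult_ac)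
  have "0 < ?K * p ^ (m' * ?K) * ?P"
    using K pos(1) by (intro mult_pos_pos) (simp_all add: prod_pos)
  with cancel have eq: "?c * ?V = ?c' * prime_free_fact p (m * ?K)"
    by (simp only: nat_mult_eq_cancel1)
  define w where "w = prime_free_fact p (p ^ r)"
  have block: "[prime_free_fact p (m * x) = w ^ (t * x)] (mod p ^ r)" for x
    using prime_free_fact_cong[OF pdvd, of "t * x"] by (simp add: t w_def mult.assoc)
  have "[?V = (\<Prod>j\<in>J. w ^ (t * k j))] (mod p ^ r)"
    by (rule cong_prod) (rule block)
  also have "(\<Prod>j\<in>J. w ^ (t * k j)) = w ^ (t * ?K)"
    by (simp add: sum_distrib_left flip: power_sum)
  finally have "[?c * w ^ (t * ?K) = ?c * ?V] (mod p ^ r)"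
    by (intro cong_mult cong_refl) (rule cong_sym)
  also have "[?c * ?V = ?c' * w ^ (t * ?K)] (mod p ^ r)"
    unfolding eq by (intro cong_mult cong_refl block)
  finally show ?thesis
    unfolding m'_def[symmetric] w_def
    using coprime_prime_free_fact[OF p(1), of "p ^ r" r]
    by (subst (asm) cong_mult_rcancel_nat) (simp_all del: coprime_power_right_iff)
qed

lemma sum_divisors_necklace_multinomial:
  fixes k :: "'i \<Rightarrow> nat"
  assumes "finite J" "Gcd (k ` J) = 1" "(\<Sum>j\<in>J. k j) > 0" "m > 0"
  shows "(\<Sum>d | d dvd m. int d * necklace (\<lambda>m. int (cyclic_multinomial k J m)) d) =
    int (cyclic_multinomial k J m)"
  by (rule sum_divisors_necklace)
    (use assms cyclic_multinomial_cong[OF assms(1-3)] in \<open>simp_all only: cong_int_iff\<close>)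

section \<open>Setting the logarithms to zero\<close>

lemma keys_add_nat:
  fixes a b :: "'v \<Rightarrow>\<^sub>0 nat"
  shows "Poly_Mapping.keys (a + b) = Poly_Mapping.keys a \<union> Poly_Mapping.keys b"
  by (auto simp: in_keys_iff lookup_add)

lemma mfps_nth_power_series_part [simp]:
  "mfps_nth (power_series_part f) e = (if Poly_Mapping.keys e \<subseteq> range Z then mfps_nth f e else 0)"
  by (simp add: power_series_part_def)

lemma power_series_part_1: "power_series_part 1 = 1"
  by (rule mfps_eqI) auto

text \<open>Dropping the logarithms is the ring homomorphism that sets them to zero, because a product of
  monomials is free of logarithms only if both factors are.\<close>

lemma power_series_part_mult: "power_series_part (f * g) = power_series_part f * power_series_part g"
proof (rule mfps_eqI)
  fix e
  show "mfps_nth (power_series_part (f * g)) e = mfps_nth (power_series_part f * power_series_part g) e"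
  proof (cases "Poly_Mapping.keys e \<subseteq> range Z")
    case True
    then show ?thesis
      unfolding mfps_nth_mult mfps_nth_power_series_part
      by (auto simp: splits_def keys_add_nat intro!: sum.cong)
  next
    case False
    then have "mfps_nth (power_series_part f * power_series_part g) e = 0"
      unfolding mfps_nth_mult mfps_nth_power_series_part
      by (intro sum.neutral) (auto simp: splits_def keys_add_nat)
    with False show ?thesis by simp
  qed
qed

lemma power_series_part_prod: "power_series_part (prod f A) = (\<Prod>x\<in>A. power_series_part (f x))"
  by (induction A rule: infinite_finite_induct)
    (simp_all add: power_series_part_1 power_series_part_mult)

lemma mfps_var_eq_monom: "mfps_var v = mfps_monom (Poly_Mapping.single v 1)"
  by (rule mfps_eqI) (simp add: mfps_var_def)

lemma mfps_monom_power: "mfps_monom f ^ m = mfps_monom (exp_scale m f)"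
  by (induction m) (simp_all add: mfps_monom_0 mfps_monom_mult)

lemma mfps_monom_prod: "(\<Prod>x\<in>A. mfps_monom (f x)) = mfps_monom (\<Sum>x\<in>A. f x)"
  by (induction A rule: infinite_finite_induct) (simp_all add: mfps_monom_0 mfps_monom_mult)

lemma single_neq_0: "Poly_Mapping.single v (1::nat) \<noteq> 0"
  by (metis lookup_single_eq lookup_zero zero_neq_one)

lemma power_series_part_zpow:
  "power_series_part (zpow i r m) = mfps_monom (Poly_Mapping.single (Z i) m)"
proof -
  define f where "f = (mfps_const r * mfps_var (LogZ i) :: (var, real) mfps)"
  have f: "mfps_nth f e = (if e = Poly_Mapping.single (LogZ i) 1 then r else 0)" for e
    by (simp add: f_def mfps_var_eq_monom)
  have f0: "mfps_nth f 0 = 0"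
    using single_neq_0[of "LogZ i"] by (simp add: f)
  have "power_series_part (mfps_exp f) = 1"
  proof (rule mfps_eqI)
    fix e
    have "mfps_nth (mfps_exp f) e = mfps_nth (mfps_exp 0) e" if "Poly_Mapping.keys e \<subseteq> range Z"
    proof (rule mfps_exp_cong[OF f0])
      fix a b assume "a + b = e"
      then have "LogZ i \<notin> Poly_Mapping.keys a"
        using that by (auto simp: keys_add_nat)
      then show "mfps_nth f a = mfps_nth 0 a"
        by (auto simp: f)
    qed
    then show "mfps_nth (power_series_part (mfps_exp f)) e = mfps_nth 1 e"
      by (auto simp: mfps_exp_0)
  qed
  moreover have "mfps_var (Z i) ^ m = (mfps_monom (Poly_Mapping.single (Z i) m) :: (var, real) mfps)"
    unfolding mfps_var_eq_monom mfps_monom_power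
    by (rule arg_cong[of _ _ mfps_monom], rule exp_scale_eqI) (simp add: lookup_single when_def)
  moreover have "power_series_part (mfps_monom (Poly_Mapping.single (Z i) m)) =
      (mfps_monom (Poly_Mapping.single (Z i) m) :: (var, real) mfps)"
    by (rule mfps_eqI) (auto split: if_splits)
  ultimately show ?thesis
    unfolding zpow_def f_def[symmetric] by (simp add: power_series_part_mult)
qed

definition zvec :: "(var \<Rightarrow>\<^sub>0 nat) \<Rightarrow> nat \<Rightarrow> nat" where
  "zvec e i = Poly_Mapping.lookup e (Z i)"

lemma zvec_exp_scale: "zvec (exp_scale m e) = (\<lambda>i. m * zvec e i)"
  by (simp add: zvec_def fun_eq_iff)

lemma zvec_in_nonneg_vecs: "Poly_Mapping.keys e \<subseteq> Z ` {..N} \<Longrightarrow> zvec e \<in> nonneg_vecs N"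
  by (force simp: zvec_def nonneg_vecs_def in_keys_iff subset_iff image_iff)

lemma monomial_eq_iff_zvec:
  assumes M: "M \<in> nonneg_vecs N"
  shows "e = (\<Sum>i\<le>N. Poly_Mapping.single (Z i) (M i)) \<longleftrightarrow> Poly_Mapping.keys e \<subseteq> Z ` {..N} \<and> zvec e = M"
proof -
  have lookup: "Poly_Mapping.lookup (\<Sum>i\<le>N. Poly_Mapping.single (Z i) (M i)) v =
      (case v of Z i \<Rightarrow> M i | LogZ _ \<Rightarrow> 0)" for v
    using M by (cases v) (auto simp: lookup_sum lookup_single when_def nonneg_vecs_def)
  show ?thesis
  proof
    assume e: "e = (\<Sum>i\<le>N. Poly_Mapping.single (Z i) (M i))"
    have "v \<in> Z ` {..N}" if "v \<in> Poly_Mapping.keys e" for v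
    proof (cases v)
      case (Z i)
      with that have "M i \<noteq> 0"
        by (simp add: in_keys_iff e lookup)
      with M have "\<not> i > N"
        by (auto simp: nonneg_vecs_def)
      with Z show ?thesis by simp
    qed (use that in \<open>simp add: in_keys_iff e lookup\<close>)
    then show "Poly_Mapping.keys e \<subseteq> Z ` {..N} \<and> zvec e = M"
      by (auto simp: zvec_def e lookup)
  next
    assume e: "Poly_Mapping.keys e \<subseteq> Z ` {..N} \<and> zvec e = M"
    show "e = (\<Sum>i\<le>N. Poly_Mapping.single (Z i) (M i))"
    proof (rule poly_mapping_eqI)
      fix v
      show "Poly_Mapping.lookup e v = Poly_Mapping.lookup (\<Sum>i\<le>N. Poly_Mapping.single (Z i) (M i)) v"
        using e by (cases v) (auto simp: lookup zvec_def in_keys_iff)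
    qed
  qed
qed

text \<open>With the logarithms set to zero, \<open>z\<^sub>i\<^bsup>r+m\<^esup>\<close> becomes \<open>z\<^sub>i\<^sup>m\<close>, so \<open>\<Omega>\<close> becomes the generating function of its
  coefficients.\<close>

lemma mfps_nth_Omega:
  assumes e: "Poly_Mapping.keys e \<subseteq> range Z"
  shows "mfps_nth (Omega N n L R) e =
    (if Poly_Mapping.keys e \<subseteq> Z ` {..N} then hyp_coeff N n L (zvec e) R else 0)"
proof -
  define t where "t M = mfps_nth (mfps_const (hyp_coeff N n L M R) * (\<Prod>i\<le>N. zpow i (R i) (M i))) e" for M
  have t: "t M = (if Poly_Mapping.keys e \<subseteq> Z ` {..N} \<and> M = zvec e then hyp_coeff N n L M R else 0)"
    if M: "M \<in> nonneg_vecs N" for M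
  proof -
    have "mfps_nth (\<Prod>i\<le>N. zpow i (R i) (M i)) e =
        mfps_nth (power_series_part (\<Prod>i\<le>N. zpow i (R i) (M i))) e"
      using e by simp
    also have "\<dots> = (if e = (\<Sum>i\<le>N. Poly_Mapping.single (Z i) (M i)) then 1 else 0)"
      by (simp only: power_series_part_prod power_series_part_zpow mfps_monom_prod mfps_nth_monom)
    finally show ?thesis
      unfolding t_def mfps_nth_const_mult monomial_eq_iff_zvec[OF M] by auto
  qed
  have "mfps_nth (Omega N n L R) e = (\<Sum>M | M \<in> nonneg_vecs N \<and> t M \<noteq> 0. t M)"
    by (simp add: Omega_def formal_sum_def t_def)
  also have "\<dots> = (\<Sum>M\<in>{M. M = zvec e \<and> M \<in> nonneg_vecs N \<and> t M \<noteq> 0}. t M)"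
    by (rule sum.cong) (auto simp: t split: if_splits)
  also have "\<dots> = (if Poly_Mapping.keys e \<subseteq> Z ` {..N} then hyp_coeff N n L (zvec e) R else 0)"
  proof (cases "zvec e \<in> nonneg_vecs N \<and> t (zvec e) \<noteq> 0")
    case True
    then have "{M. M = zvec e \<and> M \<in> nonneg_vecs N \<and> t M \<noteq> 0} = {zvec e}"
      by auto
    with True show ?thesis
      by (simp add: t split: if_splits)
  next
    case False
    then have empty: "{M. M = zvec e \<and> M \<in> nonneg_vecs N \<and> t M \<noteq> 0} = {}"
      by auto
    have "hyp_coeff N n L (zvec e) R = 0" if "Poly_Mapping.keys e \<subseteq> Z ` {..N}"
      using False that zvec_in_nonneg_vecs[OF that] t[of "zvec e"] by simp
    then show ?thesis by (simp only: empty sum.empty) simp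
  qed
  finally show ?thesis .
qed


section \<open>Expansion of the hypergeometric coefficients at the origin\<close>

lemma mfps_quot_1: "mfps_quot f 1 = f"
  unfolding mfps_quot_def by (rule the_equality) simp_all

lemma kval_zero: "kval N L j (\<lambda>_. 0) = 0"
  by (simp add: kval_def)

lemma kval_fun_upd_zero: "i \<le> N \<Longrightarrow> kval N L j ((\<lambda>_. 0)(i := r)) = of_int (L i j) * (r :: real)"
  unfolding kval_def by (subst sum.remove[of _ i]) (auto intro!: sum.neutral)

lemma kval_scale: "kval N L j (\<lambda>i. c * x i) = c * (kval N L j x :: 'a::comm_ring_1)"
  by (simp add: kval_def sum_distrib_left mult_ac)

lemma num_neg_scale: "m > 0 \<Longrightarrow> num_neg N n L (\<lambda>i. m * M i) = num_neg N n L M"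
  by (simp add: num_neg_def kval_scale mult_less_0_iff)

lemma hyp_coeff_0: "hyp_coeff N n L (\<lambda>_. 0) R = 1"
  by (simp add: hyp_coeff_def kval_zero)

lemma hyp_coeff_at_0:
  assumes "num_neg N n L M \<noteq> 0"
  shows "hyp_coeff N n L M (\<lambda>_. 0) = 0"
proof -
  have "{j. j \<le> N + n + 1 \<and> kvalM N L j M < 0} \<noteq> {}"
    using assms by (metis card.empty num_neg_def)
  then have "(\<Prod>j\<in>{j. j \<le> N + n + 1 \<and> kvalM N L j M < 0}.
      \<Prod>b<nat (- kvalM N L j M). - of_nat b + kval N L j (\<lambda>_. 0 :: real)) = 0"
    by (auto simp: kval_zero)
  then show ?thesis by (simp add: hyp_coeff_def)
qed

text \<open>Each \<open>j\<close> with negative \<open>k\<^sub>j\<close> contributes a factor \<open>b = 0\<close> that vanishes at \<open>R = 0\<close>. By Condition (A) only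
  \<open>M = 0\<close> has no such \<open>j\<close>.\<close>

lemma G0_eq_1:
  assumes A: "condition_A N n L"
  shows "G0 N n L = 1"
proof -
  have "mfps_const (hyp_coeff N n L M (\<lambda>_. 0)) * (\<Prod>i\<le>N. zpow i 0 (M i)) =
      (if M = (\<lambda>_. 0) then 1 else 0)" if "M \<in> nonneg_vecs N" for M
  proof (cases "M = (\<lambda>_. 0)")
    case True
    then show ?thesis
      by (simp add: hyp_coeff_0 mfps_const_arith zpow_def mfps_exp_0)
  next
    case False
    with A that have "num_neg N n L M \<noteq> 0"
      by (auto simp: condition_A_def)
    with False show ?thesis
      by (simp add: hyp_coeff_at_0 mfps_const_arith)
  qed
  note summand = this
  show ?thesis
  proof (rule mfps_eqI)
    fix e
    define t where "t M = mfps_nth (mfps_const (hyp_coeff N n L M (\<lambda>_. 0)) * (\<Prod>i\<le>N. zpow i 0 (M i))) e" for M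
    have t: "t M = (if M = (\<lambda>_. 0) then mfps_nth 1 e else 0)" if "M \<in> nonneg_vecs N" for M
      unfolding t_def summand[OF that] by simp
    have "mfps_nth (G0 N n L) e = (\<Sum>M | M \<in> nonneg_vecs N \<and> t M \<noteq> 0. t M)"
      by (simp add: G0_def Omega_def formal_sum_def t_def)
    also have "\<dots> = (\<Sum>M\<in>{\<lambda>_. 0}. t M)"
      by (rule sum.mono_neutral_left) (auto simp: t nonneg_vecs_def split: if_splits)
    also have "\<dots> = mfps_nth 1 e"
      by (simp add: t nonneg_vecs_def)
    finally show "mfps_nth (G0 N n L) e = mfps_nth 1 e" .
  qed
qed

lemma deriv_mult_at_0:
  fixes f h :: "real \<Rightarrow> real"
  assumes "\<And>r. f r = r * h r" "isCont h 0"
  shows "deriv f 0 = h 0"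
proof (rule DERIV_imp_deriv)
  show "(f has_field_derivative h 0) (at 0)"
    unfolding CARAT_DERIV using assms by (intro exI[of _ h]) auto
qed

lemma prod_neg_Suc: "(\<Prod>b<m. - 1 - real b) = (- 1) ^ m * fact m"
  by (induction m) (simp_all add: algebra_simps)

text \<open>Each \<open>j\<close> with negative \<open>k\<^sub>j\<close> contributes one zero at \<open>r = 0\<close> to the numerator. If \<open>j0\<close> is the only one, the
  derivative is the remaining quotient at \<open>0\<close>; a second zero makes it vanish.\<close>

lemma deriv_hyp_coeff:
  assumes i: "i \<le> N" and j0: "j0 \<le> N + n + 1" "kvalM N L j0 M < 0"
  shows "deriv (\<lambda>r. hyp_coeff N n L M ((\<lambda>_. 0)(i := r))) 0 =
    (if num_neg N n L M = 1 then
       of_int (L i j0) * (- 1) ^ (nat (- kvalM N L j0 M) - 1) * fact (nat (- kvalM N L j0 M) - 1) /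
       (\<Prod>j\<in>{..N + n + 1} - {j0}. fact (nat (kvalM N L j M)))
     else 0)"
proof -
  let ?k = "\<lambda>j. kvalM N L j M"
  define Neg where "Neg = {j. j \<le> N + n + 1 \<and> ?k j < 0}"
  define Pos where "Pos = {j. j \<le> N + n + 1 \<and> ?k j > 0}"
  have fin: "finite Neg" "finite Pos" and j0_in: "j0 \<in> Neg"
    using j0 by (simp_all add: Neg_def Pos_def)
  obtain K where K: "nat (- ?k j0) = Suc K"
    using j0 by (metis gr0_implies_Suc neg_0_less_iff_less zero_less_nat_eq)
  define P where "P j r = (\<Prod>b<nat (- ?k j). - real b + of_int (L i j) * r)" for j r
  define D where "D r = (\<Prod>j\<in>Pos. \<Prod>a=1..nat (?k j). real a + of_int (L i j) * r)" for r
  \<comment> \<open>The coefficient with the factor \<open>r\<close> coming from \<open>b = 0\<close> at \<open>j0\<close> taken out.\<close>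
  define h where "h r = of_int (L i j0) * (\<Prod>b<K. - real (Suc b) + of_int (L i j0) * r) *
      (\<Prod>j\<in>Neg - {j0}. P j r) / D r" for r
  have D0: "D 0 = (\<Prod>j\<in>Pos. fact (nat (?k j)))"
    by (simp add: D_def fact_prod)
  have "D 0 \<noteq> 0"
    unfolding D0 using fin by simp
  then have "isCont h 0"
    unfolding h_def P_def D_def by (intro continuous_intros)
  moreover have "hyp_coeff N n L M ((\<lambda>_. 0)(i := r)) = r * h r" for r
  proof -
    have "hyp_coeff N n L M ((\<lambda>_. 0)(i := r)) = (\<Prod>j\<in>Neg. P j r) / D r"
      unfolding hyp_coeff_def Neg_def Pos_def P_def D_def kval_fun_upd_zero[OF i] ..
    also have "(\<Prod>j\<in>Neg. P j r) = P j0 r * (\<Prod>j\<in>Neg - {j0}. P j r)"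
      using fin(1) j0_in by (rule prod.remove)
    also have "P j0 r = of_int (L i j0) * r * (\<Prod>b<K. - real (Suc b) + of_int (L i j0) * r)"
      unfolding P_def K prod.lessThan_Suc_shift by simp
    finally show ?thesis
      unfolding h_def by (simp only: times_divide_eq_right mult_ac)
  qed
  ultimately have deriv: "deriv (\<lambda>r. hyp_coeff N n L M ((\<lambda>_. 0)(i := r))) 0 = h 0"
    by (rule deriv_mult_at_0[rotated])
  have card: "num_neg N n L M = card Neg"
    by (simp add: num_neg_def Neg_def)
  show ?thesis
  proof (cases "num_neg N n L M = 1")
    case True
    then have Neg: "Neg = {j0}"
      using j0_in by (metis card card_1_singletonE singletonD)
    have "D 0 = (\<Prod>j\<in>{..N + n + 1} - {j0}. fact (nat (?k j)))"
      unfolding D0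
    proof (rule prod.mono_neutral_left)
      show "Pos \<subseteq> {..N + n + 1} - {j0}"
        using j0 by (auto simp: Pos_def)
    qed (auto simp: Pos_def not_less)
    then show ?thesis
      using True K by (simp add: deriv h_def Neg prod_neg_Suc)
  next
    case False
    have "Neg \<noteq> {j0}"
      using False by (auto simp: card)
    then obtain j where j: "j \<in> Neg - {j0}"
      using j0_in by blast
    then have "P j 0 = 0"
      by (auto simp: P_def Neg_def)
    then have "(\<Prod>j\<in>Neg - {j0}. P j 0) = 0"
      using j fin by (intro prod_zero) auto
    then show ?thesis
      using False by (simp add: deriv h_def)
  qed
qed

section \<open>Integrality of the mirror map\<close>

lemma mfps_nth_power_series_part_G1:
  "mfps_nth (power_series_part (G1 N n L i)) e =
    (if Poly_Mapping.keys e \<subseteq> Z ` {..N}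
     then deriv (\<lambda>r. hyp_coeff N n L (zvec e) ((\<lambda>_. 0)(i := r))) 0 else 0)"
proof (cases "Poly_Mapping.keys e \<subseteq> range Z")
  case True
  then show ?thesis
    by (simp add: G1_def mfps_nth_Omega)
qed auto

lemma zvec_eq_0_imp:
  assumes "Poly_Mapping.keys e \<subseteq> range Z" "zvec e = (\<lambda>_. 0)"
  shows "e = 0"
proof (rule poly_mapping_eqI)
  fix v
  show "Poly_Mapping.lookup e v = Poly_Mapping.lookup 0 v"
    using assms by (cases v) (auto simp: zvec_def fun_eq_iff in_keys_iff subset_iff)
qed

lemma Gcd_zvec_primitive:
  assumes "exp_content e = 1" "Poly_Mapping.keys e \<subseteq> Z ` {..N}"
  shows "Gcd (zvec e ` {..N}) = 1"
proof -
  have "Gcd (zvec e ` {..N}) dvd Poly_Mapping.lookup e v" for v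
  proof (cases "v \<in> Poly_Mapping.keys e")
    case True
    then obtain i where "v = Z i" "i \<le> N" using assms by auto
    then show ?thesis by (auto simp: zvec_def intro!: Gcd_dvd)
  qed (simp add: in_keys_iff)
  then have "Gcd (zvec e ` {..N}) dvd exp_content e"
    unfolding exp_content_def by (intro Gcd_greatest) auto
  with assms show ?thesis by simp
qed

lemma sum_kvalM_eq_0:
  assumes "\<And>i. i \<le> N \<Longrightarrow> (\<Sum>j\<in>S. L i j) = 0"
  shows "(\<Sum>j\<in>S. kvalM N L j M) = 0"
proof -
  have "(\<Sum>j\<in>S. kvalM N L j M) = (\<Sum>i\<le>N. (\<Sum>j\<in>S. L i j) * int (M i))"
    unfolding kval_def by (subst sum.swap) (simp add: sum_distrib_right)
  then show ?thesis by (simp add: assms)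
qed

text \<open>Let \<open>M\<close> be primitive, with a single negative entry \<open>k\<^sub>j = - K\<close> at \<open>j = j0\<close>. Vanishing of the row sums gives
  \<open>\<Sum>\<^bsub>j \<noteq> j0\<^esub> k\<^sub>j = K\<close>, so the coefficient at \<open>m M\<close> is, up to the sign \<open>- (-1)\<^bsup>m K\<^esup>\<close> and the factor
  \<open>L i j0\<close>, the multinomial coefficient of the \<open>m k\<^sub>j\<close> divided by \<open>m K\<close>. Condition (B) provides the
  greatest common divisor \<open>1\<close> that makes the divisor-sum criterion applicable on this ray.\<close>

theorem mirror_map_integral:
  assumes A: "condition_A N n L" and B: "condition_B N n L"
    and CY: "\<And>i. i \<le> N \<Longrightarrow> (\<Sum>j\<le>N + n + 1. L i j) = 0"
    and i: "i \<le> N"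
  shows "\<exists>F\<in>integral_series N. mirror_map N n L i = mfps_var (Z i) * F"
proof -
  define V where "V = Z ` {..N}"
  define g where "g = power_series_part (G1 N n L i)"
  have g: "mfps_nth g e = (if Poly_Mapping.keys e \<subseteq> V
     then deriv (\<lambda>r. hyp_coeff N n L (zvec e) ((\<lambda>_. 0)(i := r))) 0 else 0)" for e
    unfolding g_def V_def by (rule mfps_nth_power_series_part_G1)
  have "mfps_exp g \<in> int_series V"
  proof (rule int_series_exp_rays)
    have "zvec 0 = (\<lambda>_. 0)"
      by (simp add: zvec_def fun_eq_iff)
    then show "mfps_nth g 0 = 0"
      by (simp add: g hyp_coeff_0)
    show "Poly_Mapping.keys e \<subseteq> V" if "mfps_nth g e \<noteq> 0" for e
      using that by (simp add: g split: if_splits)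
    fix p assume p: "exp_content p = 1" and pV: "Poly_Mapping.keys p \<subseteq> V"
    define M where "M = zvec p"
    have M: "M \<in> nonneg_vecs N"
      using pV zvec_in_nonneg_vecs by (simp add: M_def V_def)
    have "p \<noteq> 0"
      using p exp_content_eq_0_iff[of p] by auto
    then have "M \<noteq> (\<lambda>_. 0)"
      using zvec_eq_0_imp[of p] pV by (auto simp: M_def V_def)
    with A M have "num_neg N n L M \<noteq> 0"
      by (auto simp: condition_A_def)
    then have "{j. j \<le> N + n + 1 \<and> kvalM N L j M < 0} \<noteq> {}"
      unfolding num_neg_def by (metis card.empty)
    then obtain j0 where j0: "j0 \<le> N + n + 1" "kvalM N L j0 M < 0"
      by auto
    define K where "K = nat (- kvalM N L j0 M)"
    define J where "J = {..N + n + 1} - {j0}"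
    define k where "k j = nat (kvalM N L j M)" for j
    have K: "K > 0"
      using j0 by (simp add: K_def)
    have coeff: "mfps_nth g (exp_scale m p) =
        (if num_neg N n L M = 1 then
           of_int (L i j0) * (- 1) ^ (m * K - 1) * fact (m * K - 1) / (\<Prod>j\<in>J. fact (m * k j))
         else 0)" if m: "m > 0" for m
    proof -
      have kv: "kvalM N L j (\<lambda>i. m * M i) = int m * kvalM N L j M" for j
        by (simp add: kval_scale)
      have "kvalM N L j0 (\<lambda>i. m * M i) < 0"
        unfolding kv using j0 m by (simp add: mult_pos_neg)
      moreover have "nat (- kvalM N L j0 (\<lambda>i. m * M i)) = m * K"
        unfolding kv K_def using j0 by (simp add: nat_mult_distrib flip: mult_minus_right)
      moreover have "nat (kvalM N L j (\<lambda>i. m * M i)) = m * k j" for j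
        unfolding kv k_def by (simp add: nat_mult_distrib)
      ultimately show ?thesis
        using deriv_hyp_coeff[OF i j0(1), of L "\<lambda>i. m * M i"] m pV
        by (simp only: g keys_exp_scale_eq zvec_exp_scale num_neg_scale if_True J_def flip: M_def)
    qed
    show "\<exists>\<sigma> b. \<forall>m>0. mfps_nth g (exp_scale m p) =
        of_int (\<sigma> ^ m * (\<Sum>q | q dvd m. int q * b q)) / of_nat m"
    proof (cases "num_neg N n L M = 1")
      case False
      then show ?thesis
        by (intro exI[of _ "\<lambda>_. 0"] exI[of _ 0]) (simp add: coeff)
    next
      case True
      then obtain j1 where j1: "{j. j \<le> N + n + 1 \<and> kvalM N L j M < 0} = {j1}"
        unfolding num_neg_def by (rule card_1_singletonE)
      have nonneg: "kvalM N L j M \<ge> 0" if "j \<in> J" for j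
      proof (rule ccontr)
        assume "\<not> kvalM N L j M \<ge> 0"
        with that have "j \<in> {j. j \<le> N + n + 1 \<and> kvalM N L j M < 0}"
          by (simp add: J_def)
        moreover have "j0 \<in> {j. j \<le> N + n + 1 \<and> kvalM N L j M < 0}"
          using j0 by simp
        ultimately have "j = j0"
          unfolding j1 by simp
        with that show False by (simp add: J_def)
      qed
      have finJ: "finite J" by (simp add: J_def)
      have "(\<Sum>j\<le>N + n + 1. kvalM N L j M) = 0"
        by (rule sum_kvalM_eq_0) (rule CY)
      moreover have "(\<Sum>j\<le>N + n + 1. kvalM N L j M) = kvalM N L j0 M + (\<Sum>j\<in>J. kvalM N L j M)"
        unfolding J_def by (rule sum.remove) (use j0 in simp_all)
      ultimately have kj0: "kvalM N L j0 M = - (\<Sum>j\<in>J. kvalM N L j M)"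
        by linarith
      have "int (\<Sum>j\<in>J. k j) = (\<Sum>j\<in>J. kvalM N L j M)"
        unfolding of_nat_sum by (rule sum.cong) (simp_all add: k_def nonneg)
      then have sumK: "(\<Sum>j\<in>J. k j) = K"
        unfolding K_def kj0 minus_minus by (metis nat_int)
      have Gcd: "Gcd (k ` J) = 1"
      proof -
        have J_dvd: "int (Gcd (k ` J)) dvd kvalM N L j M" if "j \<in> J" for j
        proof -
          have "Gcd (k ` J) dvd k j" using that by simp
          then show ?thesis using nonneg[OF that] by (simp add: k_def nat_dvd_iff int_dvd_int_iff flip: int_dvd_int_iff)
        qed
        have "int (Gcd (k ` J)) dvd kvalM N L j M" if "j \<le> N + n + 1" for j
        proof (cases "j = j0")
          case True
          \<comment> \<open>Condition (B) involves all entries, but the one at \<open>j0\<close> is a combination of the others.\<close>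
          then show ?thesis using J_dvd by (auto simp: kj0 intro: dvd_sum)
        qed (use that J_dvd in \<open>simp add: J_def\<close>)
        then have "int (Gcd (k ` J)) dvd Gcd ((\<lambda>j. kvalM N L j M) ` {..N + n + 1})"
          by (intro Gcd_greatest) auto
        also have "\<dots> = 1"
          using B M True Gcd_zvec_primitive[OF p pV[unfolded V_def]]
          by (simp add: condition_B_def M_def)
        finally show ?thesis by simp
      qed
      define c where "c = (\<lambda>m. int (cyclic_multinomial k J m))"
      have "mfps_nth g (exp_scale m p) =
          of_int (((- 1) ^ K) ^ m * (\<Sum>q | q dvd m. int q * (- L i j0 * necklace c q))) / of_nat m"
        if m: "m > 0" for m
      proof -
        have "(\<Sum>q | q dvd m. int q * (- L i j0 * necklace c q)) =
            - L i j0 * (\<Sum>q | q dvd m. int q * necklace c q)"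
          by (simp add: sum_distrib_left mult_ac sum_negf)
        also have "(\<Sum>q | q dvd m. int q * necklace c q) = c m"
          using sum_divisors_necklace_multinomial[OF finJ Gcd _ m] K sumK by (simp add: c_def)
        finally have sum: "(\<Sum>q | q dvd m. int q * (- L i j0 * necklace c q)) = - L i j0 * c m" .
        have "real (cyclic_multinomial k J m * (\<Prod>j\<in>J. fact (m * k j))) = real (m * fact (m * K - 1))"
          using cyclic_multinomial_mult_prod[OF finJ Gcd, of m] sumK by simp
        then have "real_of_int (c m) * (\<Prod>j\<in>J. fact (m * k j)) = real m * fact (m * K - 1)"
          by (simp add: c_def)
        then have quotient: "fact (m * K - 1) / (\<Prod>j\<in>J. fact (m * k j)) = real_of_int (c m) / real m"
          using m finJ by (simp add: field_simps)
        have "m * K \<noteq> 0"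
          using m K by simp
        then obtain r where r: "m * K = Suc r"
          using not0_implies_Suc by blast
        have "((- 1 :: real) ^ K) ^ m = (- 1) ^ (m * K)"
          by (simp only: power_mult[symmetric] mult.commute)
        then have sign: "(- 1 :: real) ^ (m * K - 1) = - (((- 1) ^ K) ^ m)"
          by (simp add: r)
        have "mfps_nth g (exp_scale m p) =
            of_int (L i j0) * (- 1) ^ (m * K - 1) * (fact (m * K - 1) / (\<Prod>j\<in>J. fact (m * k j)))"
          unfolding coeff[OF m] using True by simp
        also have "\<dots> = of_int (L i j0) * - (((- 1) ^ K) ^ m) * (real_of_int (c m) / real m)"
          by (simp only: quotient sign)
        also have "\<dots> = of_int (((- 1) ^ K) ^ m * (- L i j0 * c m)) / of_nat m"
          by simp
        finally show ?thesis
          unfolding sum .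
      qed
      note ray = this
      show ?thesis
        by (intro exI[of _ "(- 1) ^ K"] exI[of _ "\<lambda>q. - L i j0 * necklace c q"] allI impI) (rule ray)
    qed
  qed
  then have "mfps_exp g \<in> integral_series N"
    by (simp add: integral_series_def int_series_def V_def)
  moreover have "mirror_map N n L i = mfps_var (Z i) * mfps_exp g"
    by (simp add: mirror_map_def G0_eq_1[OF A] mfps_quot_1 g_def)
  ultimately show ?thesis by blast
qed

lemma sum_outer_brane:
  assumes "N \<ge> 1" "n \<ge> 1" and l: "\<And>i. 1 \<le> i \<Longrightarrow> i \<le> N \<Longrightarrow> (\<Sum>j<N + n. l i j) = 0" and i: "i \<le> N"
  shows "(\<Sum>j\<le>N + n + 1. outer_brane N n l i j) = 0"
proof (cases "i = 0")
  case True
  have "outer_brane N n l i j = (if j = 0 then 1 else 0) + (if j = N + n + 1 then 1 else 0)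
      - (if j = 1 then 1 else 0) - (if j = N + n then 1 else 0)" for j
    using assms(1,2) True by (auto simp: outer_brane_def)
  then show ?thesis
    using assms(1,2) by (simp add: sum.distrib sum_subtractf)
next
  case False
  have "(\<Sum>j\<le>N + n + 1. outer_brane N n l i j) = (\<Sum>j<N + n. l i j)"
    by (rule sum.mono_neutral_cong_right) (use False in \<open>auto simp: outer_brane_def\<close>)
  with False i l show ?thesis by simp
qed

lemma sum_inner_brane:
  assumes "N \<ge> 1" "n \<ge> 1" and l: "\<And>i. 1 \<le> i \<Longrightarrow> i \<le> N \<Longrightarrow> (\<Sum>j<N + n. l i j) = 0" and i: "i \<le> N"
  shows "(\<Sum>j\<le>N + n + 1. inner_brane N n l i j) = 0"
proof -
  have outer: "(\<Sum>j\<le>N + n + 1. outer_brane N n l i' j) = 0" if "i' \<le> N" for i'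
    using assms that by (intro sum_outer_brane) auto
  consider "i = 0" | "i = 1" | "i \<noteq> 0" "i \<noteq> 1" by blast
  then show ?thesis
    using outer[of 0] outer[of 1] outer[OF i] assms(1)
    by cases (simp_all add: inner_brane_def sum_negf sum.distrib del: sum.atMost_Suc)
qed

theorem theorem6p1:
  fixes N n :: nat and l :: "nat \<Rightarrow> nat \<Rightarrow> int"
  assumes "N \<ge> 1" and "n \<ge> 1"
    and calabi_yau: "\<And>i. 1 \<le> i \<Longrightarrow> i \<le> N \<Longrightarrow> (\<Sum>j<N + n. l i j) = 0"
  shows "(condition_A N n (outer_brane N n l) \<and> condition_B N n (outer_brane N n l) \<longrightarrow>
            (\<forall>i\<le>N. \<exists>F\<in>integral_series N.
               mirror_map N n (outer_brane N n l) i = mfps_var (Z i) * F)) \<and>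
         (condition_A N n (inner_brane N n l) \<and> condition_B N n (inner_brane N n l) \<longrightarrow>
            (\<forall>i\<le>N. \<exists>F\<in>integral_series N.
               mirror_map N n (inner_brane N n l) i = mfps_var (Z i) * F))"
  using sum_outer_brane[OF assms] sum_inner_brane[OF assms]
  by (auto intro!: mirror_map_integral)

end
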